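(* Let $0<q<1$. For any $t\ge 0$, $$\mu_t^{(q)}\,\mathbf{L}^{(q)}=\mu_{qt}^{(q)}.$$
   Context: $\mathcal{C}$ is the set of particle configurations $\mathbf{x}=(x_1>x_2>x_3>\dots)$ on $\mathbb{Z}$ with $x_N=-N$ for all sufficiently large $N$. $\mu^{(q)}_t$ is the distribution at time $t\ge 0$ of the TASEP with geometric speeds started from the step configuration $x_N(0)=-N$, $N\ge 1$: the $i$-th particle from the right, $x_i$, has an independent exponential clock of rate $q^{i-1}$, and when it rings the particle jumps to the right by one if the destination is empty (otherwise nothing happens). For $A\in\mathbb{Z}_{\ge 0}$ and $\alpha\in[0,1]$, $Y_\alpha(A)$ denotes a truncated geometric random variable on $\{0,1,\dots,A\}$: $\mathrm{Prob}(Y_\alpha(A)=k)=(1-\alpha)\alpha^k$ for $0\le k\le A-1$ and $\mathrm{Prob}(Y_\alpha(A)=A)=\alpha^A$. $\mathbf{L}^{(q)}$ is the Markov map (one-step transition operator) on $\mathcal{C}$ under which the random image $\hat x_1>\hat x_2>\dots$ of a configuration $x_1>x_2>\dots$ is $$\hat x_i=x_{i+1}+1+Y_{q^i}(x_i-x_{i+1}-1),\qquad i=1,2,\dots,$$ where the truncated geometric random variables for different $i$ are independent. $\mu\,\mathbf{L}^{(q)}$ denotes the law of the image of a random configuration with law $\mu$. *)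

theory Defs
  imports "HOL-Probability.Probability" "HOL-Probability.Product_PMF"
begin

text \<open>
  Particles are numbered from 0: particle \<open>k\<close> here is the \<open>(k+1)\<close>-st particle from the right,
  so \<open>part x k\<close> is $x_{k+1}$, its clock has rate \<open>q ^ k\<close>, and the step configuration is
  \<open>k \<mapsto> - (k+1)\<close>.
\<close>

typedef config =
  "{x :: nat \<Rightarrow> int. (\<forall>k. x (Suc k) < x k) \<and> (\<exists>K. \<forall>k\<ge>K. x k = - int (Suc k))}"
  morphisms part mk_config
  by (rule exI[of _ "\<lambda>k. - int (Suc k)"]) auto

definition step_config :: config where
  "step_config = mk_config (\<lambda>k. - int (Suc k))"

lemma part_step_config: "part step_config k = - int (Suc k)"
  by (simp add: step_config_def mk_config_inverse)

lemma part_less_Suc: "part x (Suc k) < part x k"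
  using part[of x] by simp

lemma part_eventually: "\<exists>K. \<forall>k\<ge>K. part x k = - int (Suc k)"
  using part[of x] by simp

definition jump :: "nat \<Rightarrow> config \<Rightarrow> config" where
  "jump k x = (if part x k + 1 \<in> range (part x) then x
               else mk_config ((part x)(k := part x k + 1)))"

lemma part_jump:
  "part (jump k x) = (if part x k + 1 \<in> range (part x) then part x
                      else (part x)(k := part x k + 1))"
proof (cases "part x k + 1 \<in> range (part x)")
  case False
  let ?y = "(part x)(k := part x k + 1)"
  have "?y (Suc j) < ?y j" for j
  proof (cases "Suc j = k")
    case True
    have "part x j \<noteq> part x k + 1" using False by (metis rangeI)
    then show ?thesis using True part_less_Suc[of x j] by auto
  next
    case False
    then show ?thesis using part_less_Suc[of x j] by auto
  qed
  moreover obtain K where "\<forall>j\<ge>K. part x j = - int (Suc j)"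
    using part_eventually by blast
  then have "\<forall>j\<ge>max K (Suc k). ?y j = - int (Suc j)" by auto
  then have "\<exists>K. \<forall>j\<ge>K. ?y j = - int (Suc j)" by blast
  ultimately show ?thesis using False by (simp add: jump_def mk_config_inverse)
qed (simp add: jump_def)

text \<open>
  TASEP is built from its clocks: a sample point \<open>\<omega>\<close> assigns to each pair \<open>(k, n)\<close> the waiting
  time of the clock of particle \<open>k\<close> between its \<open>n\<close>-th and \<open>(n+1)\<close>-st ring, starting from time 0.
\<close>

definition clocks :: "real \<Rightarrow> (nat \<times> nat \<Rightarrow> real) measure" where
  "clocks q = PiM UNIV (\<lambda>(k, n). density lborel (exponential_density (q ^ k)))"

definition ring_time :: "(nat \<times> nat \<Rightarrow> real) \<Rightarrow> nat \<Rightarrow> nat \<Rightarrow> real" where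
  "ring_time \<omega> k n = (\<Sum>m\<le>n. \<omega> (k, m))"

definition rings_upto :: "real \<Rightarrow> (nat \<times> nat \<Rightarrow> real) \<Rightarrow> real set" where
  "rings_upto t \<omega> = {s. s \<le> t \<and> (\<exists>k n. s = ring_time \<omega> k n)}"

definition ringing :: "(nat \<times> nat \<Rightarrow> real) \<Rightarrow> real \<Rightarrow> nat" where
  "ringing \<omega> s = (LEAST k. \<exists>n. s = ring_time \<omega> k n)"

text \<open>
  Since the rates \<open>q ^ k\<close> are summable, almost surely only finitely many clocks ring up to time
  \<open>t\<close>, and they ring at distinct times. The path is obtained by carrying out the attempted jumps
  in chronological order; the choice of \<open>LEAST\<close> in \<open>ringing\<close> and the value \<open>[]\<close> of
  \<open>sorted_list_of_set\<close> on an infinite set only matter on null events.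
\<close>

definition tasep :: "real \<Rightarrow> (nat \<times> nat \<Rightarrow> real) \<Rightarrow> config" where
  "tasep t \<omega> = fold (\<lambda>s. jump (ringing \<omega> s)) (sorted_list_of_set (rings_upto t \<omega>)) step_config"

lemma measurable_ring_time: "(\<lambda>\<omega>. ring_time \<omega> k n) \<in> borel_measurable (clocks q)"
proof -
  have "(\<lambda>\<omega>. \<omega> (k, m)) \<in> borel_measurable (clocks q)" for m
    unfolding clocks_def
    by (rule measurable_compose[OF measurable_component_singleton]) auto
  then show ?thesis unfolding ring_time_def by (intro borel_measurable_sum) auto
qed

lemma measurable_tasep: "tasep t \<in> measurable (clocks q) (count_space UNIV)"
proof -
  note [measurable] = measurable_ring_time
  let ?T = "\<lambda>\<omega> p. ring_time \<omega> (fst p) (snd p)"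
  let ?word = "\<lambda>\<omega>. map (ringing \<omega>) (sorted_list_of_set (rings_upto t \<omega>))"
  let ?P = "\<lambda>w ps \<omega>. sorted_wrt (<) (map (?T \<omega>) ps) \<and> (\<forall>p\<in>set ps. ?T \<omega> p \<le> t)
     \<and> (\<forall>k n. ring_time \<omega> k n \<le> t \<longrightarrow> (\<exists>p\<in>set ps. ?T \<omega> p = ring_time \<omega> k n))
     \<and> map (\<lambda>p. ringing \<omega> (?T \<omega> p)) ps = w"
  have word: "?word \<omega> = w \<longleftrightarrow> (\<exists>ps. ?P w ps \<omega>)" if "w \<noteq> []" for w \<omega>
  proof
    assume w: "?word \<omega> = w"
    with that have fin: "finite (rings_upto t \<omega>)"
      by (metis list.simps(8) sorted_list_of_set.fold_insort_key.infinite)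
    define f where "f s = (SOME p. s = ?T \<omega> p)" for s
    have f: "?T \<omega> (f s) = s" if "s \<in> rings_upto t \<omega>" for s
    proof -
      have "\<exists>p. s = ?T \<omega> p" using that by (force simp: rings_upto_def)
      then show ?thesis unfolding f_def by (metis (mono_tags, lifting) someI_ex)
    qed
    let ?l = "sorted_list_of_set (rings_upto t \<omega>)"
    have l: "map (?T \<omega>) (map f ?l) = ?l"
      unfolding map_map using f fin by (intro map_idI) auto
    have "sorted_wrt (<) (map (?T \<omega>) (map f ?l))" unfolding l by simp
    moreover have "map (\<lambda>p. ringing \<omega> (?T \<omega> p)) (map f ?l) = w"
      using f fin w by auto
    moreover have "\<exists>p\<in>set (map f ?l). ?T \<omega> p = ring_time \<omega> k n" if "ring_time \<omega> k n \<le> t" for k n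
    proof -
      have "ring_time \<omega> k n \<in> rings_upto t \<omega>" using that by (auto simp: rings_upto_def)
      with f fin show ?thesis by force
    qed
    moreover have "\<forall>p\<in>set (map f ?l). ?T \<omega> p \<le> t"
      using f fin by (auto simp: rings_upto_def)
    ultimately have "?P w (map f ?l) \<omega>" by (intro conjI allI impI)
    then show "\<exists>ps. ?P w ps \<omega>" by blast
  next
    assume "\<exists>ps. ?P w ps \<omega>"
    then obtain ps where ps: "?P w ps \<omega>" by blast
    have "rings_upto t \<omega> \<subseteq> set (map (?T \<omega>) ps)"
    proof
      fix s assume "s \<in> rings_upto t \<omega>"
      then obtain k n where "s = ring_time \<omega> k n" "s \<le> t" by (auto simp: rings_upto_def)
      then obtain p where "p \<in> set ps" "?T \<omega> p = s" using ps by metis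
      then show "s \<in> set (map (?T \<omega>) ps)" by auto
    qed
    moreover have "set (map (?T \<omega>) ps) \<subseteq> rings_upto t \<omega>"
      using ps by (auto simp: rings_upto_def)
    ultimately have set_eq: "set (map (?T \<omega>) ps) = rings_upto t \<omega>" by blast
    have idem: "sorted xs \<Longrightarrow> distinct xs \<Longrightarrow> sorted_list_of_set (set xs) = xs" for xs :: "real list"
      by (simp add: sorted_list_of_set.idem_if_sorted_distinct)
    have "sorted (map (?T \<omega>) ps)" "distinct (map (?T \<omega>) ps)"
      using ps strict_sorted_iff by blast+
    then have "sorted_list_of_set (rings_upto t \<omega>) = map (?T \<omega>) ps"
      unfolding set_eq[symmetric] by (rule idem)
    then show "?word \<omega> = w" using ps by (simp add: o_def)
  qed
  have eq_times [measurable]: "Measurable.pred (clocks q) (\<lambda>\<omega>. ring_time \<omega> k n = ring_time \<omega> k' n')"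
    for k n k' n'
    unfolding pred_def by (intro borel_measurable_eq measurable_ring_time)
  have le_times [measurable]: "Measurable.pred (clocks q) (\<lambda>\<omega>. ring_time \<omega> k n \<le> t)" for k n
    unfolding pred_def by (intro borel_measurable_le measurable_ring_time borel_measurable_const)
  have ringing: "Measurable.pred (clocks q) (\<lambda>\<omega>. ringing \<omega> (?T \<omega> p) = k)" for p k
    unfolding ringing_def by measurable
  have labels: "Measurable.pred (clocks q) (\<lambda>\<omega>. map (\<lambda>p. ringing \<omega> (?T \<omega> p)) ps = w)" for w ps
  proof (cases "length ps = length w")
    case True
    have "Measurable.pred (clocks q) (\<lambda>\<omega>. \<forall>i\<in>{..<length w}. ringing \<omega> (?T \<omega> (ps ! i)) = w ! i)"
      using ringing by (intro pred_intros_countable_bounded) auto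
    moreover have "map (\<lambda>p. ringing \<omega> (?T \<omega> p)) ps = w \<longleftrightarrow>
        (\<forall>i\<in>{..<length w}. ringing \<omega> (?T \<omega> (ps ! i)) = w ! i)" for \<omega>
      by (subst list_eq_iff_nth_eq) (use True in auto)
    ultimately show ?thesis by (simp only:)
  next
    case False
    then have "(map (\<lambda>p. ringing \<omega> (?T \<omega> p)) ps = w) = False" for \<omega> by auto
    then show ?thesis by simp
  qed
  have sorted: "Measurable.pred (clocks q) (\<lambda>\<omega>. sorted_wrt (<) (map (?T \<omega>) ps))" for ps
    by (induction ps) (simp_all, measurable)
  have cover: "Measurable.pred (clocks q) (\<lambda>\<omega>. (\<forall>p\<in>set ps. ?T \<omega> p \<le> t)
     \<and> (\<forall>k n. ring_time \<omega> k n \<le> t \<longrightarrow> (\<exists>p\<in>set ps. ?T \<omega> p = ring_time \<omega> k n)))" for ps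
    by measurable
  have P: "Measurable.pred (clocks q) (\<lambda>\<omega>. ?P w ps \<omega>)" for w ps
    using pred_intros_logic(3)[OF sorted pred_intros_logic(3)[OF cover labels]]
    by (simp only: conj_assoc)
  have eq: "Measurable.pred (clocks q) (\<lambda>\<omega>. ?word \<omega> = w)" if "w \<noteq> []" for w
    unfolding word[OF that] using P by (rule pred_intros_countable(2))
  have "Measurable.pred (clocks q) (\<lambda>\<omega>. \<exists>w\<in>- {[]}. ?word \<omega> = w)"
    using eq by (intro pred_intros_countable_bounded) auto
  then have "Measurable.pred (clocks q) (\<lambda>\<omega>. \<not> (\<exists>w\<in>- {[]}. ?word \<omega> = w))"
    by (rule pred_intros_logic)
  then have "Measurable.pred (clocks q) (\<lambda>\<omega>. ?word \<omega> = [])" by simp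
  with eq have all: "Measurable.pred (clocks q) (\<lambda>\<omega>. ?word \<omega> = w)" for w
    by (cases "w = []") auto
  have "?word -` {w} \<inter> space (clocks q) \<in> sets (clocks q)" for w
    using all[of w] unfolding pred_def by (simp add: vimage_def Int_def conj_commute)
  then have "?word \<in> measurable (clocks q) (count_space UNIV)"
    by (subst measurable_count_space_eq2_countable) auto
  then have "(\<lambda>\<omega>. fold jump (?word \<omega>) step_config) \<in> measurable (clocks q) (count_space UNIV)"
    by (rule measurable_compose) simp
  then show ?thesis
    by (simp add: tasep_def[abs_def] fold_map o_def)
qed

text \<open>There are only countably many configurations; laws on them are measures on all subsets.\<close>

definition tasep_law :: "real \<Rightarrow> real \<Rightarrow> config measure" where
  "tasep_law q t = distr (clocks q) (count_space UNIV) (tasep t)"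

definition trunc_geometric :: "real \<Rightarrow> nat \<Rightarrow> nat pmf" where
  "trunc_geometric \<alpha> A =
     embed_pmf (\<lambda>k. if k < A then (1 - \<alpha>) * \<alpha> ^ k else if k = A then \<alpha> ^ A else 0)"

lemma pmf_trunc_geometric:
  assumes "0 \<le> \<alpha>" "\<alpha> \<le> 1"
  shows "pmf (trunc_geometric \<alpha> A) k =
           (if k < A then (1 - \<alpha>) * \<alpha> ^ k else if k = A then \<alpha> ^ A else 0)"
proof -
  let ?f = "\<lambda>k. if k < A then (1 - \<alpha>) * \<alpha> ^ k else if k = A then \<alpha> ^ A else 0"
  have nonneg: "0 \<le> ?f k" for k using assms by simp
  have total: "(\<Sum>k<A. (1 - \<alpha>) * \<alpha> ^ k) = 1 - \<alpha> ^ A"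
    by (metis one_diff_power_eq sum_distrib_left)
  have "(\<integral>\<^sup>+k. ennreal (?f k) \<partial>count_space UNIV) = (\<Sum>k\<le>A. ennreal (?f k))"
    by (subst nn_integral_count_space'[of "{..A}"]) (auto simp: not_le)
  also have "\<dots> = ennreal (\<Sum>k\<le>A. ?f k)"
    using nonneg by (intro sum_ennreal)
  also have "(\<Sum>k\<le>A. ?f k) = 1"
    using total by (simp add: lessThan_Suc_atMost[symmetric])
  finally have "(\<integral>\<^sup>+k. ennreal (?f k) \<partial>count_space UNIV) = 1" by simp
  with nonneg show ?thesis
    unfolding trunc_geometric_def by (rule pmf_embed_pmf)
qed

lemma set_trunc_geometric:
  assumes "0 \<le> \<alpha>" "\<alpha> \<le> 1"
  shows "set_pmf (trunc_geometric \<alpha> A) \<subseteq> {..A}"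
  using assms by (auto simp: set_pmf_iff pmf_trunc_geometric split: if_splits)

definition gap :: "config \<Rightarrow> nat \<Rightarrow> nat" where
  "gap x k = nat (part x k - part x (Suc k) - 1)"

text \<open>
  The product runs over the finitely many particles with a nonzero gap; for the others
  the truncated geometric variable is identically 0, the default value.
\<close>

definition Lmap :: "real \<Rightarrow> config \<Rightarrow> config pmf" where
  "Lmap q x =
     map_pmf (\<lambda>Y. mk_config (\<lambda>k. part x (Suc k) + 1 + int (Y k)))
       (Pi_pmf {k. gap x k \<noteq> 0} 0 (\<lambda>k. trunc_geometric (q ^ Suc k) (gap x k)))"

lemma finite_gap: "finite {k. gap x k \<noteq> 0}"
proof -
  obtain K where K: "\<forall>k\<ge>K. part x k = - int (Suc k)"
    using part_eventually by blast
  have "k < K" if "gap x k \<noteq> 0" for k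
  proof (rule ccontr)
    assume "\<not> k < K"
    then have "part x k = - int (Suc k)" "part x (Suc k) = - int (Suc (Suc k))"
      using K by auto
    with that show False by (simp add: gap_def)
  qed
  then have "{k. gap x k \<noteq> 0} \<subseteq> {..<K}" by blast
  then show ?thesis by (rule finite_subset) simp
qed

lemma part_Lmap:
  assumes "0 \<le> q" "q \<le> 1"
    and "Y \<in> set_pmf (Pi_pmf {k. gap x k \<noteq> 0} 0 (\<lambda>k. trunc_geometric (q ^ Suc k) (gap x k)))"
  shows "part (mk_config (\<lambda>k. part x (Suc k) + 1 + int (Y k))) =
           (\<lambda>k. part x (Suc k) + 1 + int (Y k))"
proof -
  let ?y = "\<lambda>k. part x (Suc k) + 1 + int (Y k)"
  have Y: "Y k \<in> (if gap x k \<noteq> 0 then set_pmf (trunc_geometric (q ^ Suc k) (gap x k)) else {0})" for k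
    using subsetD[OF set_Pi_pmf_subset'[OF finite_gap] assms(3)]
    unfolding PiE_dflt_def by auto
  have Yle: "Y k \<le> gap x k" for k
  proof -
    have "0 \<le> q ^ Suc k" "q ^ Suc k \<le> 1"
      using assms(1,2) by (simp, intro power_le_one)
    then have "set_pmf (trunc_geometric (q ^ Suc k) (gap x k)) \<subseteq> {..gap x k}"
      by (rule set_trunc_geometric)
    then show ?thesis
      using Y[of k] by (cases "gap x k = 0") (simp, fastforce simp del: power_Suc)
  qed
  have "?y (Suc k) < ?y k" for k
    using Yle[of "Suc k"] part_less_Suc[of x "Suc k"] unfolding gap_def by linarith
  moreover obtain K where K: "\<forall>k\<ge>K. part x k = - int (Suc k)"
    using part_eventually by blast
  have "?y k = - int (Suc k)" if "k \<ge> K" for k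
  proof -
    have "part x k = - int (Suc k)" "part x (Suc k) = - int (Suc (Suc k))"
      using K that by auto
    then show ?thesis using Yle[of k] unfolding gap_def by simp
  qed
  then have "\<exists>K. \<forall>k\<ge>K. ?y k = - int (Suc k)" by blast
  ultimately show ?thesis
    by (intro mk_config_inverse CollectI conjI allI)
qed

end

theory Submission
  imports Defs
begin

text \<open>
  Up to uniformization, TASEP is the chain that at each ring of a Poisson clock of rate
  \<open>1 / (1 - q)\<close> lets particle \<open>k\<close> attempt a jump with probability \<open>(1 - q) q ^ k\<close>. Resampling
  particle \<open>i\<close> with parameter \<open>\<alpha>\<close> intertwines this chain with the one in which the speeds of
  particles \<open>i\<close> and \<open>i + 1\<close> are exchanged, provided that their ratio is \<open>\<alpha>\<close>. Performing these
  resamplings for \<open>i = 0, 1, 2, \<dots>\<close> carries the fastest particle to infinity and turns the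
  speeds $1, q, q^2, \dots$ into $q, q^2, q^3, \dots$, that is, slows time down by the factor
  \<open>q\<close>. The composition of the resamplings is \<open>Lmap q\<close>, which fixes the step configuration.
  In the uniformized chain the slowdown means that each step is kept with probability \<open>q\<close>
  only, so the Poisson number of steps is thinned to a Poisson number of mean \<open>q\<close> times as large.
\<close>

section \<open>Exchanging the speeds of neighbouring particles\<close>

lemma part_strict_antimono: "i < j \<Longrightarrow> part x j < part x i"
  by (induction j) (auto simp: less_Suc_eq intro: part_less_Suc less_trans[OF part_less_Suc])

lemma config_eqI: "(\<And>k. part x k = part y k) \<Longrightarrow> x = y"
  by (simp add: part_inject[symmetric] fun_eq_iff)

lemma int_gap: "int (gap x k) = part x k - part x (Suc k) - 1"
  using part_less_Suc[of x k] by (simp add: gap_def)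

lemma part_jump_0: "part (jump 0 x) = (part x)(0 := part x 0 + 1)"
proof -
  have "part x 0 + 1 \<noteq> part x k" for k
    using part_strict_antimono[of 0 k x] by (cases "k = 0") auto
  then show ?thesis by (auto simp: part_jump)
qed

text \<open>By the ordering only the particle directly ahead can occupy the target site, so blocking
  is a condition on one gap.\<close>

lemma part_jump_Suc:
  "part (jump (Suc j) x) =
     (if gap x j = 0 then part x else (part x)(Suc j := part x (Suc j) + 1))"
proof -
  have "part x (Suc j) + 1 \<in> range (part x) \<longleftrightarrow> gap x j = 0"
  proof
    assume "part x (Suc j) + 1 \<in> range (part x)"
    then obtain k where k: "part x k = part x (Suc j) + 1" by force
    then have "\<not> Suc j < k" "k \<noteq> Suc j" using part_strict_antimono[of "Suc j" k x] by auto
    then have "k \<le> j" by simp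
    then have "part x j \<le> part x k" using part_strict_antimono[of k j x]
      by (cases "k = j") auto
    then show "gap x j = 0" using k by (simp add: gap_def)
  next
    assume "gap x j = 0"
    then have "part x (Suc j) + 1 = part x j" using int_gap[of x j] by simp
    then show "part x (Suc j) + 1 \<in> range (part x)" by simp
  qed
  then show ?thesis by (simp add: part_jump)
qed

lemma jump_blocked: "gap x j = 0 \<Longrightarrow> jump (Suc j) x = x"
  by (simp add: part_inject[symmetric] part_jump_Suc)

text \<open>Here \<open>h\<close> is the new gap between particle \<open>i\<close> and the one
  behind it. Values of \<open>h\<close> too large for the room ahead of particle \<open>i\<close>
  give no configuration, hence the condition in \<open>part_place\<close>.\<close>

definition place :: "nat \<Rightarrow> config \<Rightarrow> nat \<Rightarrow> config" where
  "place i x h = mk_config ((part x)(i := part x (Suc i) + 1 + int h))"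

lemma part_place:
  assumes "\<And>j. i = Suc j \<Longrightarrow> part x (Suc i) + 1 + int h < part x j"
  shows "part (place i x h) = (part x)(i := part x (Suc i) + 1 + int h)"
proof -
  let ?y = "(part x)(i := part x (Suc i) + 1 + int h)"
  have "?y (Suc j) < ?y j" for j
    using assms[of j] part_less_Suc[of x j] by auto
  moreover obtain K where "\<forall>j\<ge>K. part x j = - int (Suc j)"
    using part_eventually by blast
  then have "\<forall>j\<ge>max K (Suc i). ?y j = - int (Suc j)" by auto
  then have "\<exists>K. \<forall>j\<ge>K. ?y j = - int (Suc j)" by blast
  ultimately show ?thesis by (simp add: place_def mk_config_inverse)
qed

lemma part_place_le_gap:
  assumes "h \<le> gap x i"
  shows "part (place i x h) = (part x)(i := part x (Suc i) + 1 + int h)"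
proof (rule part_place)
  fix j assume "i = Suc j"
  then show "part x (Suc i) + 1 + int h < part x j"
    using assms int_gap[of x i] part_less_Suc[of x j] by simp
qed

lemma gap_jump_other: "k \<noteq> i \<Longrightarrow> k \<noteq> Suc i \<Longrightarrow> gap (jump k x) i = gap x i"
  by (cases k) (auto simp: gap_def part_jump_0 part_jump_Suc)

lemma jump_place_other:
  assumes "k \<noteq> i" "k \<noteq> Suc i" "h \<le> gap x i"
  shows "jump k (place i x h) = place i (jump k x) h"
proof (rule config_eqI)
  fix l
  have "h \<le> gap (jump k x) i" using assms by (simp add: gap_jump_other)
  then have *: "part (place i (jump k x) h) = (part (jump k x))(i := part (jump k x) (Suc i) + 1 + int h)"
    by (rule part_place_le_gap)
  show "part (jump k (place i x h)) l = part (place i (jump k x) h) l"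
  proof (cases k)
    case 0
    then show ?thesis unfolding * using assms by (auto simp: part_jump_0 part_place_le_gap)
  next
    case (Suc j)
    then have "gap (place i x h) j = gap x j"
      using assms by (simp add: gap_def part_place_le_gap)
    then show ?thesis unfolding * using assms Suc by (auto simp: part_jump_Suc part_place_le_gap)
  qed
qed

lemma gap_jump_Suc: "gap (jump (Suc i) x) i = gap x i - 1"
  by (auto simp: gap_def part_jump_Suc)

text \<open>The position of particle \<open>i\<close> is measured from particle
  \<open>Suc i\<close>, so once the latter has moved, the same position is described by
  \<open>h - 1\<close>; for \<open>h = 0\<close> the two are adjacent and the jump is
  blocked.\<close>

lemma jump_Suc_place:
  assumes "h \<le> gap x i"
  shows "jump (Suc i) (place i x h) =
           (if h = 0 then place i x 0 else place i (jump (Suc i) x) (h - 1))"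
proof -
  have g: "gap (place i x h) i = h" using assms by (simp add: gap_def part_place_le_gap)
  show ?thesis
  proof (cases "h = 0")
    case True
    then show ?thesis using g by (simp add: jump_blocked)
  next
    case False
    then have "h - 1 \<le> gap (jump (Suc i) x) i" "gap x i \<noteq> 0"
      using assms by (auto simp: gap_jump_Suc)
    then show ?thesis using False assms g
      by (intro config_eqI) (auto simp: part_jump_Suc part_place_le_gap)
  qed
qed

definition blocked :: "nat \<Rightarrow> config \<Rightarrow> bool" where
  "blocked i x \<longleftrightarrow> (\<exists>j. i = Suc j \<and> gap x j = 0)"

lemma gap_jump: "gap (jump i x) i = (if blocked i x then gap x i else Suc (gap x i))"
  using part_less_Suc[of x i]
  by (cases i) (auto simp: gap_def part_jump_0 part_jump_Suc blocked_def Suc_nat_eq_nat_zadd1)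

lemma place_jump: "place i (jump i x) h = place i x h"
  by (cases i) (auto simp: place_def part_jump_0 part_jump_Suc)

text \<open>If \<open>h\<close> is less than the gap, particle \<open>i\<close> was set back
  strictly behind its old site and has a free site ahead; only at its old site does the old blocking
  matter.\<close>

lemma jump_place:
  assumes "h \<le> gap x i"
  shows "jump i (place i x h) =
           (if blocked i x \<and> h = gap x i then place i x h else place i x (Suc h))"
proof (cases i)
  case 0
  have "part (place 0 x n) = (part x)(0 := part x (Suc 0) + 1 + int n)" for n
    by (rule part_place) auto
  then show ?thesis using 0 by (intro config_eqI) (auto simp: part_jump_0 blocked_def)
next
  case (Suc j)
  have g: "gap (place i x h) j = 0 \<longleftrightarrow> blocked i x \<and> h = gap x i"
  proof -
    have "int (gap (place i x h) j) = int (gap x j) + (int (gap x i) - int h)"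
      using assms Suc by (simp add: int_gap part_place_le_gap)
    then show ?thesis using assms Suc by (auto simp: blocked_def)
  qed
  show ?thesis
  proof (cases "blocked i x \<and> h = gap x i")
    case True
    then show ?thesis using g Suc by (simp add: jump_blocked)
  next
    case False
    \<comment> \<open>\<open>Suc h\<close> may exceed \<open>gap x i\<close> by one, so
      \<open>part_place_le_gap\<close> does not suffice; in that case particle \<open>i\<close> is
      not blocked and there is room ahead.\<close>
    have "part (place i x (Suc h)) = (part x)(i := part x (Suc i) + 1 + int (Suc h))"
    proof (rule part_place)
      fix j' assume "i = Suc j'"
      then show "part x (Suc i) + 1 + int (Suc h) < part x j'"
        using Suc False assms int_gap[of x i] int_gap[of x j] by (auto simp: blocked_def)
    qed
    then show ?thesis using False g Suc assms
      by (intro config_eqI) (auto simp: part_jump_Suc part_place_le_gap)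
  qed
qed

section \<open>Truncated geometric variables and the exchange identity\<close>

lemma set_trunc_geometric_le:
  assumes "0 \<le> \<alpha>" "\<alpha> \<le> 1" "h \<in> set_pmf (trunc_geometric \<alpha> g)"
  shows "h \<le> g"
  using set_trunc_geometric[OF assms(1,2)] assms(3) by auto

lemma pmf_bind_bernoulli:
  assumes "0 \<le> p" "p \<le> 1"
  shows "pmf (bind_pmf (bernoulli_pmf p) (\<lambda>b. if b then A else B)) z =
           p * pmf A z + (1 - p) * pmf B z"
  using assms by (simp add: pmf_bind)

lemma trunc_geometric_0: "0 \<le> \<alpha> \<Longrightarrow> \<alpha> \<le> 1 \<Longrightarrow> trunc_geometric \<alpha> 0 = return_pmf 0"
  by (intro pmf_eqI) (simp add: pmf_trunc_geometric pmf_return indicator_def)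

text \<open>This is the lack of memory of a geometric variable capped at \<open>Suc g\<close>:
  unless the first trial gives 0, the count starts afresh with cap \<open>g\<close>.\<close>

lemma trunc_geometric_Suc:
  assumes "0 \<le> \<alpha>" "\<alpha> \<le> 1"
  shows "trunc_geometric \<alpha> (Suc g) =
    bind_pmf (bernoulli_pmf \<alpha>) (\<lambda>b. if b then map_pmf Suc (trunc_geometric \<alpha> g) else return_pmf 0)"
proof (rule pmf_eqI)
  fix k
  show "pmf (trunc_geometric \<alpha> (Suc g)) k =
    pmf (bind_pmf (bernoulli_pmf \<alpha>)
      (\<lambda>b. if b then map_pmf Suc (trunc_geometric \<alpha> g) else return_pmf 0)) k"
  proof (cases k)
    case 0
    have "pmf (map_pmf Suc (trunc_geometric \<alpha> g)) 0 = 0"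
      by (auto simp: pmf_eq_0_set_pmf)
    then show ?thesis using 0 assms by (simp add: pmf_bind_bernoulli pmf_trunc_geometric)
  next
    case (Suc j)
    have "pmf (map_pmf Suc (trunc_geometric \<alpha> g)) (Suc j) = pmf (trunc_geometric \<alpha> g) j"
      by (rule pmf_map_inj') simp
    then show ?thesis using Suc assms by (simp add: pmf_bind_bernoulli pmf_trunc_geometric)
  qed
qed

text \<open>Capping a geometric variable at \<open>Suc g\<close> and then at \<open>g\<close>
  amounts to capping it at \<open>g\<close>. This serves the case of a blocked particle
  \<open>i\<close>.\<close>

lemma map_trunc_geometric_min:
  assumes "0 \<le> \<alpha>" "\<alpha> \<le> 1"
  shows "map_pmf (\<lambda>h. min h g) (trunc_geometric \<alpha> (Suc g)) = trunc_geometric \<alpha> g"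
proof (induction g)
  case 0
  show ?case using assms by (simp add: trunc_geometric_0 map_pmf_const)
next
  case (Suc g)
  have "map_pmf (\<lambda>h. min h (Suc g)) (trunc_geometric \<alpha> (Suc (Suc g))) =
    bind_pmf (bernoulli_pmf \<alpha>) (\<lambda>b. if b then map_pmf Suc (map_pmf (\<lambda>h. min h g)
      (trunc_geometric \<alpha> (Suc g))) else return_pmf 0)"
    unfolding trunc_geometric_Suc[OF assms, of "Suc g"] map_bind_pmf
    by (intro bind_pmf_cong) (auto simp: pmf.map_comp o_def min_def intro!: map_pmf_cong)
  then show ?case unfolding Suc.IH by (simp only: trunc_geometric_Suc[OF assms, of g])
qed

definition resample :: "nat \<Rightarrow> real \<Rightarrow> config \<Rightarrow> config pmf" where
  "resample i \<alpha> x = map_pmf (place i x) (trunc_geometric \<alpha> (gap x i))"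

lemma resample_jump_other:
  assumes "0 \<le> \<alpha>" "\<alpha> \<le> 1" "k \<noteq> i" "k \<noteq> Suc i"
  shows "resample i \<alpha> (jump k x) = map_pmf (jump k) (resample i \<alpha> x)"
  unfolding resample_def pmf.map_comp gap_jump_other[OF assms(3,4)]
  using assms set_trunc_geometric_le by (intro map_pmf_cong) (auto simp: jump_place_other)

text \<open>
  Both \<open>jump (Suc i)\<close> applied after the resampling and \<open>jump i\<close> applied before it reduce to the
  recursion that a truncated geometric variable for \<open>Suc g\<close> is, with probability \<open>\<alpha>\<close>, one more
  than a truncated geometric variable for \<open>g\<close>, and 0 otherwise.
\<close>

lemma resample_jump_pair:
  assumes \<alpha>: "0 \<le> \<alpha>" "\<alpha> \<le> 1"
  shows "pmf (resample i \<alpha> (jump i x)) z + \<alpha> * pmf (resample i \<alpha> (jump (Suc i) x)) z =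
    \<alpha> * pmf (map_pmf (jump i) (resample i \<alpha> x)) z + pmf (map_pmf (jump (Suc i)) (resample i \<alpha> x)) z"
proof -
  let ?F = "place i x" and ?F' = "place i (jump (Suc i) x)" and ?T = "trunc_geometric \<alpha>"
  have 1: "map_pmf (jump i) (resample i \<alpha> x) =
      map_pmf (\<lambda>h. if blocked i x \<and> h = gap x i then ?F h else ?F (Suc h)) (?T (gap x i))"
    unfolding resample_def pmf.map_comp
    using \<alpha> set_trunc_geometric_le by (intro map_pmf_cong) (auto simp: jump_place)
  have 2: "map_pmf (jump (Suc i)) (resample i \<alpha> x) =
      map_pmf (\<lambda>h. if h = 0 then ?F 0 else ?F' (h - 1)) (?T (gap x i))"
    unfolding resample_def pmf.map_comp
    using \<alpha> set_trunc_geometric_le by (intro map_pmf_cong) (auto simp: jump_Suc_place)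
  have 3: "resample i \<alpha> (jump i x) = map_pmf ?F (?T (if blocked i x then gap x i else Suc (gap x i)))"
    unfolding resample_def gap_jump by (intro map_pmf_cong) (auto simp: place_jump)
  show ?thesis
  proof (cases "gap x i")
    \<comment> \<open>Without a gap, particle \<open>Suc i\<close> is blocked before and after the
      resampling, so only the moves of particle \<open>i\<close> need comparing.\<close>
    case 0
    have "jump (Suc i) x = x" using 0 by (rule jump_blocked)
    then have 4: "resample i \<alpha> (jump (Suc i) x) = return_pmf (?F 0)"
      using 0 \<alpha> by (simp add: resample_def trunc_geometric_0)
    have 5: "map_pmf ?F (?T (Suc 0)) =
       bind_pmf (bernoulli_pmf \<alpha>) (\<lambda>b. if b then return_pmf (?F (Suc 0)) else return_pmf (?F 0))"
      unfolding trunc_geometric_Suc[OF \<alpha>] map_bind_pmf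
      using \<alpha> by (intro bind_pmf_cong) (auto simp: trunc_geometric_0)
    show ?thesis
      unfolding 1 2 3 4 using 0 \<alpha> 5 pmf_bind_bernoulli[OF \<alpha>, of "return_pmf (?F (Suc 0))" "return_pmf (?F 0)" z]
      by (auto simp: trunc_geometric_0 algebra_simps)
  next
    case (Suc g)
    have 4: "resample i \<alpha> (jump (Suc i) x) = map_pmf ?F' (?T g)"
      using Suc by (simp add: resample_def gap_jump_Suc)
    have "map_pmf (\<lambda>h. if h = 0 then ?F 0 else ?F' (h - 1)) (?T (Suc g)) =
       bind_pmf (bernoulli_pmf \<alpha>) (\<lambda>b. if b then map_pmf ?F' (?T g) else return_pmf (?F 0))"
      unfolding trunc_geometric_Suc[OF \<alpha>] map_bind_pmf
      by (intro bind_pmf_cong) (auto simp: pmf.map_comp o_def)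
    then have 5: "pmf (map_pmf (jump (Suc i)) (resample i \<alpha> x)) z =
        \<alpha> * pmf (map_pmf ?F' (?T g)) z + (1 - \<alpha>) * pmf (return_pmf (?F 0)) z"
      unfolding 2 Suc by (simp only: pmf_bind_bernoulli[OF \<alpha>])
    \<comment> \<open>This has the shape of \<open>5\<close>, so the multiples of
      \<open>return_pmf (?F 0)\<close> agree on the two sides of the claim.\<close>
    have "resample i \<alpha> (jump i x) = bind_pmf (bernoulli_pmf \<alpha>)
        (\<lambda>b. if b then map_pmf (jump i) (resample i \<alpha> x) else return_pmf (?F 0))"
    proof (cases "blocked i x")
      case False
      then show ?thesis
        unfolding 1 3 Suc by (subst if_not_P, assumption, subst trunc_geometric_Suc[OF \<alpha>], unfold map_bind_pmf)
          (intro bind_pmf_cong, auto simp: pmf.map_comp o_def)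
    next
      case True
      \<comment> \<open>A blocked particle at the top value \<open>Suc g\<close> stays there, so the
        jump sends \<open>h\<close> to \<open>Suc (min h g)\<close>.\<close>
      have "map_pmf (\<lambda>h. if blocked i x \<and> h = Suc g then ?F h else ?F (Suc h)) (?T (Suc g)) =
          map_pmf ?F (map_pmf Suc (map_pmf (\<lambda>h. min h g) (?T (Suc g))))"
        unfolding pmf.map_comp using True set_trunc_geometric_le[OF \<alpha>, of _ "Suc g"]
        by (intro map_pmf_cong) (auto simp: min_def le_Suc_eq)
      also have "\<dots> = map_pmf ?F (map_pmf Suc (?T g))"
        unfolding map_trunc_geometric_min[OF \<alpha>] ..
      finally have *: "map_pmf (jump i) (resample i \<alpha> x) = map_pmf ?F (map_pmf Suc (?T g))"
        unfolding 1 Suc .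
      have "resample i \<alpha> (jump i x) = map_pmf ?F (?T (Suc g))" unfolding 3 using True Suc by simp
      then show ?thesis unfolding * trunc_geometric_Suc[OF \<alpha>, of g] map_bind_pmf
        by (simp add: if_distrib[of "map_pmf ?F"] cong: if_cong)
    qed
    then have 6: "pmf (resample i \<alpha> (jump i x)) z =
        \<alpha> * pmf (map_pmf (jump i) (resample i \<alpha> x)) z + (1 - \<alpha>) * pmf (return_pmf (?F 0)) z"
      by (simp only: pmf_bind_bernoulli[OF \<alpha>])
    show ?thesis unfolding 4 5 6 by (simp add: algebra_simps)
  qed
qed

text \<open>\<open>c\<close> is the law of the ringing label. Jumps of other particles commute with
  the resampling, so only the labels \<open>i\<close> and \<open>Suc i\<close> contribute to the
  difference of the two sides. As their weights have ratio \<alpha>, this contribution is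
  \<open>pmf c i\<close> times a difference that vanishes by
  \<open>resample_jump_pair\<close>.\<close>

lemma resample_swap:
  assumes \<alpha>: "0 \<le> \<alpha>" "\<alpha> \<le> 1" and c: "pmf c (Suc i) = \<alpha> * pmf c i"
  shows "bind_pmf c (\<lambda>k. resample i \<alpha> (jump k x)) =
    bind_pmf (resample i \<alpha> x) (\<lambda>y. map_pmf (\<lambda>k. jump k y) (map_pmf (Transposition.transpose i (Suc i)) c))"
proof (rule pmf_eqI)
  fix z
  let ?\<tau> = "Transposition.transpose i (Suc i)"
  let ?a = "\<lambda>k. pmf (resample i \<alpha> (jump k x)) z"
  let ?b = "\<lambda>k. pmf (map_pmf (jump (?\<tau> k)) (resample i \<alpha> x)) z"
  have eq: "bind_pmf (resample i \<alpha> x) (\<lambda>y. map_pmf (\<lambda>k. jump k y) (map_pmf ?\<tau> c)) =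
      bind_pmf c (\<lambda>k. map_pmf (jump (?\<tau> k)) (resample i \<alpha> x))"
    unfolding map_pmf_def bind_assoc_pmf bind_return_pmf by (rule bind_commute_pmf)
  have int: "integrable (measure_pmf c) (\<lambda>k. pmf (K k) z)" for K :: "nat \<Rightarrow> config pmf"
    by (rule measure_pmf.integrable_const_bound[where B = 1]) (auto simp: pmf_le_1)
  have "(\<integral>k. ?a k \<partial>c) - (\<integral>k. ?b k \<partial>c) = (\<integral>k. ?a k - ?b k \<partial>c)"
    by (rule Bochner_Integration.integral_diff[symmetric]) (rule int)+
  also have "\<dots> = (\<Sum>k\<in>{i, Suc i}. (?a k - ?b k) * pmf c k)"
  proof (rule integral_measure_pmf_real)
    fix k assume "?a k - ?b k \<noteq> 0"
    then show "k \<in> {i, Suc i}"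
      using resample_jump_other[OF \<alpha>, of k i x] by (cases "k = i \<or> k = Suc i") auto
  qed simp
  also have "\<dots> = pmf c i * (?a i + \<alpha> * ?a (Suc i) - (\<alpha> * ?b (Suc i) + ?b i))"
    by (simp add: c algebra_simps)
  also have "\<dots> = 0" using resample_jump_pair[OF \<alpha>, of i x z] by simp
  finally show "pmf (bind_pmf c (\<lambda>k. resample i \<alpha> (jump k x))) z =
    pmf (bind_pmf (resample i \<alpha> x) (\<lambda>y. map_pmf (\<lambda>k. jump k y) (map_pmf ?\<tau> c))) z"
    unfolding eq by (simp add: pmf_bind)
qed

section \<open>The map L as a composition of exchanges\<close>

text \<open>Resampling from the front backwards lets each particle see the original position of the
  particle behind it, as in \<open>Lmap\<close>.\<close>

primrec sweep :: "real \<Rightarrow> nat \<Rightarrow> config \<Rightarrow> config pmf" where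
  "sweep q 0 x = return_pmf x"
| "sweep q (Suc N) x = bind_pmf (sweep q N x) (resample N (q ^ Suc N))"

text \<open>\<open>geometric_pmf (1 - q)\<close> gives label \<open>k\<close> the weight
  \<open>(1 - q) * q ^ k\<close>, the share of its clock in the total rate.\<close>

primrec labels :: "real \<Rightarrow> nat \<Rightarrow> nat pmf" where
  "labels q 0 = geometric_pmf (1 - q)"
| "labels q (Suc N) = map_pmf (Transposition.transpose N (Suc N)) (labels q N)"

text \<open>Each exchange moves the weight of the fastest particle one label back and gives the
  label it leaves the weight of its successor. So label \<open>Suc N\<close> has
  \<open>q ^ Suc N\<close> times the weight of label \<open>N\<close>, which is the parameter of the
  next resampling in \<open>sweep\<close>.\<close>

lemma pmf_labels:
  assumes "0 < q" "q < 1"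
  shows "pmf (labels q N) k =
    (1 - q) * (if k < N then q ^ Suc k else if k = N then 1 else q ^ k)"
proof (induction N arbitrary: k)
  case 0
  show ?case using assms by simp
next
  case (Suc N)
  let ?\<tau> = "Transposition.transpose N (Suc N)"
  have "pmf (map_pmf ?\<tau> (labels q N)) (?\<tau> (?\<tau> k)) = pmf (labels q N) (?\<tau> k)"
    by (rule pmf_map_inj') simp
  then have "pmf (labels q (Suc N)) k = pmf (labels q N) (?\<tau> k)"
    by simp
  then show ?case unfolding Suc.IH by (auto simp: Transposition.transpose_def)
qed

text \<open>Induction on \<open>N\<close>: the hypothesis passes the jump through the first
  \<open>N\<close> resamplings, and \<open>resample_swap\<close> passes it through the next one at
  the price of transposing two labels.\<close>

lemma sweep_intertwining:
  assumes q: "0 < q" "q < 1"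
  shows "bind_pmf (geometric_pmf (1 - q)) (\<lambda>k. sweep q N (jump k x)) =
    bind_pmf (sweep q N x) (\<lambda>y. map_pmf (\<lambda>k. jump k y) (labels q N))"
proof (induction N)
  case 0
  show ?case by (simp add: map_pmf_def bind_return_pmf)
next
  case (Suc N)
  let ?\<alpha> = "q ^ Suc N"
  have \<alpha>: "0 \<le> ?\<alpha>" "?\<alpha> \<le> 1" using q by (auto intro: power_le_one simp del: power_Suc)
  have c: "pmf (labels q N) (Suc N) = ?\<alpha> * pmf (labels q N) N"
    using pmf_labels[OF q] by simp
  have "bind_pmf (geometric_pmf (1 - q)) (\<lambda>k. sweep q (Suc N) (jump k x)) =
      bind_pmf (bind_pmf (geometric_pmf (1 - q)) (\<lambda>k. sweep q N (jump k x))) (resample N ?\<alpha>)"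
    by (simp add: bind_assoc_pmf)
  also have "\<dots> = bind_pmf (sweep q N x)
      (\<lambda>y. bind_pmf (labels q N) (\<lambda>k. resample N ?\<alpha> (jump k y)))"
    unfolding Suc.IH by (simp add: bind_assoc_pmf bind_map_pmf)
  also have "\<dots> = bind_pmf (sweep q (Suc N) x) (\<lambda>y. map_pmf (\<lambda>k. jump k y) (labels q (Suc N)))"
    unfolding resample_swap[OF \<alpha> c] by (simp add: bind_assoc_pmf)
  finally show ?case .
qed

section \<open>Identification of the composed exchanges with the map L\<close>

definition refill :: "nat \<Rightarrow> config \<Rightarrow> (nat \<Rightarrow> nat) \<Rightarrow> config" where
  "refill N x Y = mk_config (\<lambda>k. if k < N then part x (Suc k) + 1 + int (Y k) else part x k)"

lemma part_refill:
  assumes "\<And>k. k < N \<Longrightarrow> Y k \<le> gap x k"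
  shows "part (refill N x Y) = (\<lambda>k. if k < N then part x (Suc k) + 1 + int (Y k) else part x k)"
proof -
  let ?y = "\<lambda>k. if k < N then part x (Suc k) + 1 + int (Y k) else part x k"
  have "?y (Suc k) < ?y k" for k
    using assms[of "Suc k"] int_gap[of x "Suc k"] part_less_Suc[of x k] by auto
  moreover obtain K where "\<forall>k\<ge>K. part x k = - int (Suc k)"
    using part_eventually by blast
  then have "\<forall>k\<ge>max K N. ?y k = - int (Suc k)" by auto
  then have "\<exists>K. \<forall>k\<ge>K. ?y k = - int (Suc k)" by blast
  ultimately show ?thesis by (simp add: refill_def mk_config_inverse)
qed

abbreviation fillings :: "real \<Rightarrow> nat set \<Rightarrow> config \<Rightarrow> (nat \<Rightarrow> nat) pmf" where
  "fillings q A x \<equiv> Pi_pmf A 0 (\<lambda>k. trunc_geometric (q ^ Suc k) (gap x k))"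

lemma fillings_le_gap:
  assumes "0 \<le> q" "q \<le> 1" "finite A" "Y \<in> set_pmf (fillings q A x)"
  shows "Y k \<le> gap x k"
proof (cases "k \<in> A")
  case True
  then have "Y k \<in> set_pmf (trunc_geometric (q ^ Suc k) (gap x k))"
    using subsetD[OF set_Pi_pmf_subset' assms(4)] assms(3) by (auto simp: PiE_dflt_def)
  then show ?thesis
    using assms(1,2) by (intro set_trunc_geometric_le) (auto intro: power_le_one simp del: power_Suc)
next
  case False
  then show ?thesis using set_Pi_pmf_subset assms(3,4) by fastforce
qed

text \<open>When particle \<open>N\<close> is resampled, it and particle \<open>Suc N\<close> are
  still in their original places, so its variable has the original gap as cap and is independent of
  the earlier ones.\<close>

lemma sweep_eq_refill:
  assumes q: "0 \<le> q" "q \<le> 1"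
  shows "sweep q N x = map_pmf (refill N x) (fillings q {..<N} x)"
proof (induction N)
  case 0
  show ?case by (simp add: refill_def part_inverse)
next
  case (Suc N)
  let ?T = "trunc_geometric (q ^ Suc N) (gap x N)"
  have T: "h \<le> gap x N" if "h \<in> set_pmf ?T" for h
    using q that by (intro set_trunc_geometric_le) (auto intro: power_le_one simp del: power_Suc)
  have step: "resample N (q ^ Suc N) (refill N x Y) = map_pmf (\<lambda>h. refill (Suc N) x (Y(N := h))) ?T"
    if Y: "Y \<in> set_pmf (fillings q {..<N} x)" for Y
  proof -
    have le: "Y k \<le> gap x k" for k using fillings_le_gap[OF q _ Y] by simp
    have y: "part (refill N x Y) = (\<lambda>k. if k < N then part x (Suc k) + 1 + int (Y k) else part x k)"
      using le by (rule part_refill)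
    then have g: "gap (refill N x Y) N = gap x N" by (simp add: gap_def)
    show ?thesis unfolding resample_def g
      by (intro map_pmf_cong refl) (auto simp: place_def refill_def[of "Suc N"] y less_Suc_eq fun_eq_iff
            intro!: arg_cong[of _ _ mk_config])
  qed
  have "sweep q (Suc N) x = bind_pmf (fillings q {..<N} x) (\<lambda>Y. resample N (q ^ Suc N) (refill N x Y))"
    by (simp add: Suc.IH bind_map_pmf)
  also have "\<dots> = bind_pmf (fillings q {..<N} x) (\<lambda>Y. map_pmf (\<lambda>h. refill (Suc N) x (Y(N := h))) ?T)"
    using step by (intro bind_pmf_cong) auto
  also have "\<dots> = bind_pmf ?T (\<lambda>h. map_pmf (\<lambda>Y. refill (Suc N) x (Y(N := h))) (fillings q {..<N} x))"
    unfolding map_pmf_def by (rule bind_commute_pmf)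
  also have "\<dots> = map_pmf (refill (Suc N) x) (fillings q {..<Suc N} x)"
    unfolding lessThan_Suc by (subst Pi_pmf_insert')
      (auto simp: map_pmf_def bind_assoc_pmf bind_return_pmf)
  finally show ?case .
qed

text \<open>From \<open>N\<close> on the gaps vanish, so the variables there are 0 and the particles
  keep their places: finitely many exchanges already give \<open>Lmap\<close>.\<close>

lemma Lmap_eq_sweep:
  assumes q: "0 \<le> q" "q \<le> 1" and N: "\<And>k. N \<le> k \<Longrightarrow> gap x k = 0"
  shows "Lmap q x = sweep q N x"
proof -
  have sub: "{k. gap x k \<noteq> 0} \<subseteq> {..<N}"
    by (rule subsetI, rule ccontr) (use N in \<open>simp add: not_less\<close>)
  have "trunc_geometric (q ^ Suc k) (gap x k) = return_pmf 0" if "gap x k = 0" for k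
    unfolding that using q by (intro trunc_geometric_0) (auto intro: power_le_one simp del: power_Suc)
  then have fill: "fillings q {..<N} x = fillings q {k. gap x k \<noteq> 0} x"
    using sub by (intro Pi_pmf_subset') auto
  show ?thesis
    unfolding sweep_eq_refill[OF q] Lmap_def fill
  proof (intro map_pmf_cong refl)
    fix Y assume Y: "Y \<in> set_pmf (fillings q {k. gap x k \<noteq> 0} x)"
    have "part x (Suc k) + 1 + int (Y k) = part x k" if "k \<ge> N" for k
      using fillings_le_gap[OF q finite_gap Y, of k] N[OF that] int_gap[of x k] by simp
    then show "mk_config (\<lambda>k. part x (Suc k) + 1 + int (Y k)) = refill N x Y"
      by (auto simp: refill_def intro!: arg_cong[of _ _ mk_config])
  qed
qed

text \<open>
  After the \<open>N\<close> exchanges, label \<open>N\<close> carries the excess mass \<open>1 - q\<close>; if particle \<open>N\<close> and all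
  those behind it are blocked, that mass amounts to not moving.
\<close>

lemma jump_labels:
  assumes q: "0 < q" "q < 1" and N: "\<And>k. N \<le> k \<Longrightarrow> jump k y = y"
  shows "map_pmf (\<lambda>k. jump k y) (labels q N) =
    bind_pmf (bernoulli_pmf q)
      (\<lambda>b. if b then map_pmf (\<lambda>k. jump k y) (geometric_pmf (1 - q)) else return_pmf y)"
    (is "?l = ?r")
proof -
  \<comment> \<open>Not moving is written as a ring of label \<open>N\<close>, which leaves
    \<open>y\<close> unchanged.\<close>
  let ?c = "bind_pmf (bernoulli_pmf q) (\<lambda>b. if b then geometric_pmf (1 - q) else return_pmf N)"
  \<comment> \<open>Labels from \<open>N\<close> on act trivially on \<open>y\<close>. Once they are
    lumped together, the two laws need comparing only below \<open>N\<close>.\<close>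
  let ?m = "\<lambda>k. min k N"
  have c: "pmf ?c k = (1 - q) * (q ^ Suc k + (if k = N then 1 else 0))" for k
    using q by (subst pmf_bind_bernoulli) (auto simp: algebra_simps)
  have small: "measure_pmf.prob p (?m -` {k}) = pmf p k" if "k < N" for p :: "nat pmf" and k
  proof -
    have "?m -` {k} = {k}" using that by (auto simp: min_def split: if_splits)
    then show ?thesis by (simp add: measure_pmf_single)
  qed
  have big: "measure_pmf.prob p (?m -` {N}) = 1 - (\<Sum>k<N. pmf p k)" for p :: "nat pmf"
  proof -
    have "measure_pmf.prob p (- {..<N}) = 1 - measure_pmf.prob p {..<N}"
      using measure_pmf.prob_compl[of "{..<N}" p] by (simp add: Compl_eq_Diff_UNIV)
    moreover have "?m -` {N} = - {..<N}" by (auto simp: min_def split: if_splits)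
    ultimately show ?thesis by (simp add: measure_measure_pmf_finite)
  qed
  have eq: "map_pmf ?m (labels q N) = map_pmf ?m ?c"
  proof (rule pmf_eqI)
    fix k
    consider "k < N" | "k = N" | "k > N" by linarith
    then show "pmf (map_pmf ?m (labels q N)) k = pmf (map_pmf ?m ?c) k"
    proof cases
      case 1
      then show ?thesis using q by (simp add: pmf_map small c pmf_labels)
    next
      case 2
      have "(\<Sum>k<N. pmf (labels q N) k) = (\<Sum>k<N. pmf ?c k)"
        using q by (intro sum.cong) (auto simp: c pmf_labels)
      then show ?thesis unfolding 2 pmf_map big by simp
    next
      case 3
      then have "?m -` {k} = {}" by auto
      then show ?thesis by (simp add: pmf_map)
    qed
  qed
  have m: "jump (?m k) y = jump k y" for k using N[of N] N[of k] by (auto simp: min_def)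
  have "?l = map_pmf (\<lambda>k. jump k y) (map_pmf ?m (labels q N))"
    by (simp add: pmf.map_comp o_def m)
  also have "\<dots> = map_pmf (\<lambda>k. jump k y) ?c"
    unfolding eq by (simp add: pmf.map_comp o_def m)
  also have "\<dots> = ?r"
    unfolding map_bind_pmf using N[of N] by (intro bind_pmf_cong) auto
  finally show ?thesis .
qed

text \<open>One \<open>N\<close> serves for \<open>x\<close> and for every \<open>jump k x\<close>,
  so \<open>sweep_intertwining\<close> applies to \<open>Lmap\<close>; after the sweep the particles
  from \<open>N\<close> on are blocked, as \<open>jump_labels\<close> requires.\<close>

lemma Lmap_intertwining:
  assumes q: "0 < q" "q < 1"
  shows "bind_pmf (geometric_pmf (1 - q)) (\<lambda>k. Lmap q (jump k x)) =
    bind_pmf (Lmap q x) (\<lambda>y. bind_pmf (bernoulli_pmf q)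
      (\<lambda>b. if b then map_pmf (\<lambda>k. jump k y) (geometric_pmf (1 - q)) else return_pmf y))"
proof -
  from q have q': "0 \<le> q" "q \<le> 1" by auto
  obtain M where M: "gap x k = 0" if "k \<ge> M" for k
  proof -
    obtain M where "{k. gap x k \<noteq> 0} \<subseteq> {..<M}"
      using finite_gap finite_nat_iff_bounded by blast
    then show ?thesis by (intro that[of M]) (force simp: not_less[symmetric])
  qed
  \<comment> \<open>A jump of particle \<open>M\<close> can open gap \<open>M\<close>, while no jump
    opens a later one.\<close>
  let ?N = "Suc M"
  have jump: "Lmap q (jump k x) = sweep q ?N (jump k x)" for k
  proof (rule Lmap_eq_sweep[OF q'])
    fix j assume j: "?N \<le> j"
    show "gap (jump k x) j = 0"
    proof (cases "k = j")
      case True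
      then obtain j' where "k = Suc j'" "M \<le> j'" using j by (cases j) auto
      then have "jump k x = x" using M by (simp add: jump_blocked)
      then show ?thesis using M j by simp
    next
      case False
      then show ?thesis using M[of j] j gap_jump_other[of k j x] gap_jump_Suc[of j x]
        by (cases "k = Suc j") auto
    qed
  qed
  have L: "Lmap q x = sweep q ?N x" using M by (intro Lmap_eq_sweep[OF q']) auto
  have "jump k y = y" if y: "y \<in> set_pmf (sweep q ?N x)" and k: "?N \<le> k" for y k
  proof -
    obtain Y where Y: "Y \<in> set_pmf (fillings q {..<?N} x)" "y = refill ?N x Y"
      using y unfolding sweep_eq_refill[OF q'] set_map_pmf by blast
    have le: "Y k \<le> gap x k" for k using fillings_le_gap[OF q' _ Y(1)] by simp
    obtain j where j: "k = Suc j" "M \<le> j" using k by (cases k) auto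
    have "gap y j = 0"
      using part_refill[OF le, of ?N] M[OF j(2)] le[of j] Y(2) j(2) int_gap[of x j] by (auto simp: gap_def)
    then show ?thesis using j by (simp add: jump_blocked)
  qed
  then show ?thesis unfolding jump L sweep_intertwining[OF q]
    by (intro bind_pmf_cong refl jump_labels[OF q]) auto
qed

section \<open>Thinning of the steps of the uniformized chain\<close>

definition run :: "real \<Rightarrow> nat \<Rightarrow> config \<Rightarrow> config pmf" where
  "run q n x = map_pmf (\<lambda>w. fold jump w x) (replicate_pmf n (geometric_pmf (1 - q)))"

lemma run_0: "run q 0 x = return_pmf x"
  by (simp add: run_def)

lemma run_Suc: "run q (Suc n) x = bind_pmf (geometric_pmf (1 - q)) (\<lambda>k. run q n (jump k x))"
  by (simp add: run_def map_bind_pmf map_pmf_def bind_assoc_pmf bind_return_pmf)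

text \<open>Pulling \<open>Lmap\<close> through one step keeps that step with probability
  \<open>q\<close>, independently of the others, so the number of kept steps is binomial.\<close>

lemma run_Lmap:
  assumes q: "0 < q" "q < 1"
  shows "bind_pmf (run q n x) (Lmap q) =
    bind_pmf (Lmap q x) (\<lambda>y. bind_pmf (binomial_pmf n q) (\<lambda>m. run q m y))"
proof (induction n arbitrary: x)
  case 0
  show ?case using q by (simp add: run_0 binomial_pmf_0 bind_return_pmf bind_return_pmf')
next
  case (Suc n)
  let ?G = "geometric_pmf (1 - q)"
  let ?R = "\<lambda>y. bind_pmf (binomial_pmf n q) (\<lambda>m. run q m y)"
  have "bind_pmf (run q (Suc n) x) (Lmap q) = bind_pmf (bind_pmf ?G (\<lambda>k. Lmap q (jump k x))) ?R"
    by (simp add: run_Suc bind_assoc_pmf Suc.IH)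
  also have "\<dots> = bind_pmf (Lmap q x) (\<lambda>y. bind_pmf (bernoulli_pmf q)
      (\<lambda>b. bind_pmf (if b then map_pmf (\<lambda>k. jump k y) ?G else return_pmf y) ?R))"
    unfolding Lmap_intertwining[OF q] by (simp add: bind_assoc_pmf)
  also have "\<dots> = bind_pmf (Lmap q x) (\<lambda>y. bind_pmf (binomial_pmf (Suc n) q) (\<lambda>m. run q m y))"
  proof (intro bind_pmf_cong refl)
    fix y
    have "bind_pmf (map_pmf (\<lambda>k. jump k y) ?G) ?R = bind_pmf (binomial_pmf n q) (\<lambda>m. run q (Suc m) y)"
      unfolding run_Suc bind_map_pmf by (rule bind_commute_pmf)
    then have "bind_pmf (if b then map_pmf (\<lambda>k. jump k y) ?G else return_pmf y) ?R =
        bind_pmf (binomial_pmf n q) (\<lambda>m. run q ((if b then 1 else 0) + m) y)" for b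
      by (simp add: bind_return_pmf)
    then show "bind_pmf (bernoulli_pmf q)
        (\<lambda>b. bind_pmf (if b then map_pmf (\<lambda>k. jump k y) ?G else return_pmf y) ?R) =
        bind_pmf (binomial_pmf (Suc n) q) (\<lambda>m. run q m y)"
      using q by (subst binomial_pmf_Suc) (auto simp: bind_assoc_pmf bind_return_pmf)
  qed
  finally show ?case .
qed

section \<open>Thinning of the Poisson number of steps\<close>

text \<open>\<open>poisson_pmf r\<close> is specified for positive \<open>r\<close> only.\<close>

definition count_pmf :: "real \<Rightarrow> nat pmf" where
  "count_pmf r = (if r = 0 then return_pmf 0 else poisson_pmf r)"

lemma pmf_count: "0 \<le> r \<Longrightarrow> pmf (count_pmf r) n = r ^ n / fact n * exp (- r)"
  by (cases n) (auto simp: count_pmf_def)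

lemma count_binomial:
  assumes q: "0 \<le> q" "q \<le> 1" and r: "0 \<le> r"
  shows "bind_pmf (count_pmf r) (\<lambda>n. binomial_pmf n q) = count_pmf (q * r)"
proof (rule pmf_eqI)
  fix m
  let ?f = "\<lambda>n. pmf (count_pmf r) n * pmf (binomial_pmf n q) m"
  \<comment> \<open>Terms with fewer than \<open>m\<close> trials vanish; the shift by
    \<open>m\<close> leaves a multiple of the exponential series at
    \<open>(1 - q) * r\<close>.\<close>
  have f: "?f (n + m) = (q * r) ^ m / fact m * exp (- r) * (((1 - q) * r) ^ n / fact n)" for n
  proof -
    have "real ((n + m) choose m) = fact (n + m) / (fact m * fact n)"
      using binomial_fact[of m "n + m", where 'a = real] by simp
    moreover have "pmf (binomial_pmf (n + m) q) m = real ((n + m) choose m) * q ^ m * (1 - q) ^ n"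
      using q by simp
    ultimately have "?f (n + m) = r ^ (n + m) / fact (n + m) * exp (- r) *
        (fact (n + m) / (fact m * fact n) * q ^ m * (1 - q) ^ n)"
      using r by (simp add: pmf_count)
    then show ?thesis by (simp add: power_add power_mult_distrib)
  qed
  have "(\<lambda>n. ((1 - q) * r) ^ n / fact n) sums exp ((1 - q) * r)"
    using exp_converges[of "(1 - q) * r"] by (simp add: divide_inverse mult.commute)
  from sums_mult[OF this, of "(q * r) ^ m / fact m * exp (- r)"]
  have "(\<lambda>n. ?f (n + m)) sums ((q * r) ^ m / fact m * exp (- r) * exp ((1 - q) * r))"
    unfolding f .
  moreover have "(\<Sum>n<m. ?f n) = 0" using q by (intro sum.neutral) (auto simp: binomial_eq_0)
  moreover have "exp (- r) * exp ((1 - q) * r) = exp (- (q * r))"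
    by (simp add: exp_add[symmetric] algebra_simps)
  ultimately have "?f sums ((q * r) ^ m / fact m * exp (- (q * r)))"
    by (subst sums_iff_shift'[of _ m, symmetric]) (simp add: mult.assoc)
  moreover have "?f sums (\<integral>n. pmf (binomial_pmf n q) m \<partial>count_pmf r)"
  proof -
    have "integrable (count_pmf r) (\<lambda>n. pmf (binomial_pmf n q) m)"
      by (rule measure_pmf.integrable_const_bound[where B = 1]) (auto simp: pmf_le_1)
    then have "integrable (count_space UNIV) ?f"
      unfolding measure_pmf_eq_density by (subst (asm) integrable_density) auto
    then have "?f sums (\<integral>n. ?f n \<partial>count_space UNIV)"
      by (rule sums_integral_count_space_nat)
    then show ?thesis
      unfolding measure_pmf_eq_density by (subst integral_density) auto
  qed
  ultimately show "pmf (bind_pmf (count_pmf r) (\<lambda>n. binomial_pmf n q)) m = pmf (count_pmf (q * r)) m"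
    unfolding pmf_bind using q r by (simp add: pmf_count sums_iff)
qed

section \<open>Memorylessness of the clocks\<close>

definition wait :: "real \<Rightarrow> nat \<times> nat \<Rightarrow> real measure" where
  "wait q i = density lborel (exponential_density (q ^ fst i))"

lemma clocks_eq: "clocks q = PiM UNIV (wait q)"
  unfolding clocks_def by (intro PiM_cong refl) (auto simp: wait_def)

lemma sets_wait [measurable_cong, simp]: "sets (wait q i) = sets borel"
  by (simp add: wait_def)

lemma space_wait [simp]: "space (wait q i) = UNIV"
  by (simp add: wait_def)

lemma space_clocks [simp]: "space (clocks q) = UNIV"
  by (simp add: clocks_eq space_PiM)

lemma sets_clocks [measurable_cong]: "sets (clocks q) = sets (PiM UNIV (\<lambda>_. borel))"
  unfolding clocks_eq by (intro sets_PiM_cong) auto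

lemma prob_space_wait: "0 < q \<Longrightarrow> prob_space (wait q i)"
  unfolding wait_def by (intro prob_space_exponential_density) auto

lemma prob_space_clocks: "0 < q \<Longrightarrow> prob_space (clocks q)"
  unfolding clocks_eq by (intro prob_space_PiM prob_space_wait)

lemma measurable_clocksI:
  assumes "\<And>i. (\<lambda>x. f x i) \<in> borel_measurable M"
  shows "f \<in> measurable M (clocks q)"
  unfolding clocks_eq
  by (rule measurable_PiM_single'[where f = "\<lambda>i x. f x i"])
    (use assms in \<open>simp_all add: measurable_cong_sets[OF refl sets_wait]\<close>)

lemma measurable_clock [measurable]: "(\<lambda>\<omega>. \<omega> i) \<in> borel_measurable (clocks q)"
  unfolding measurable_cong_sets[OF sets_clocks refl] by (rule measurable_component_singleton) simp

lemma emeasure_clocks_cylinder: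
  assumes q: "0 < q" and J: "finite J" and X: "\<And>i. i \<in> J \<Longrightarrow> X i \<in> sets borel"
  shows "emeasure (clocks q) {\<omega>. \<forall>i\<in>J. \<omega> i \<in> X i} = (\<Prod>i\<in>J. emeasure (wait q i) (X i))"
proof -
  interpret product_prob_space "wait q" UNIV
    using prob_space_wait[OF q] by (simp add: product_prob_space_def product_prob_space_axioms_def
        product_sigma_finite_def prob_space_imp_sigma_finite)
  have "{\<omega>. \<forall>i\<in>J. \<omega> i \<in> X i} = prod_emb UNIV (wait q) J (Pi\<^sub>E J X)"
    by (auto simp: prod_emb_def space_PiM PiE_iff restrict_def)
  then show ?thesis
    unfolding clocks_eq using J X by (simp add: emeasure_PiM_emb)
qed

lemma emeasure_wait_shift:
  assumes q: "0 < q" and s: "0 \<le> s" and [measurable]: "A \<in> sets borel"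
  shows "emeasure (wait q i) {x. s < x \<and> x - s \<in> A} =
    ennreal (exp (- (s * q ^ fst i))) * emeasure (wait q i) A"
proof -
  let ?l = "q ^ fst i"
  have l: "0 < ?l" using q by simp
  have "emeasure (wait q i) {x. s < x \<and> x - s \<in> A} =
      (\<integral>\<^sup>+x. ennreal (exponential_density ?l x) * indicator {x. s < x \<and> x - s \<in> A} x \<partial>lborel)"
    unfolding wait_def by (subst emeasure_density) auto
  also have "\<dots> = (\<integral>\<^sup>+x. ennreal (exponential_density ?l (s + x)) *
      indicator {x. s < x \<and> x - s \<in> A} (s + x) \<partial>lborel)"
    by (subst nn_integral_real_affine[where c = 1 and t = s]) auto
  also have "\<dots> = (\<integral>\<^sup>+x. ennreal (exp (- (s * ?l))) *
      (ennreal (exponential_density ?l x) * indicator A x) \<partial>lborel)"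
  \<comment> \<open>At \<open>x = 0\<close> the strict inequality excludes the point on the left
    only; a single point is null.\<close>
  proof (rule nn_integral_cong_AE, use AE_lborel_singleton[of "0::real"] in eventually_elim)
    fix x :: real assume "x \<noteq> 0"
    show "ennreal (exponential_density ?l (s + x)) * indicator {x. s < x \<and> x - s \<in> A} (s + x) =
        ennreal (exp (- (s * ?l))) * (ennreal (exponential_density ?l x) * indicator A x)"
    proof (cases "0 < x")
      case True
      have "exponential_density ?l (s + x) = exp (- (s * ?l)) * exponential_density ?l x"
        using True s by (simp add: exponential_density_def exp_add[symmetric] algebra_simps)
      then show ?thesis using True l
        by (auto simp: indicator_def ennreal_mult exponential_density_nonneg)
    next
      case False
      then show ?thesis using \<open>x \<noteq> 0\<close> by (simp add: exponential_density_def)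
    qed
  qed
  also have "\<dots> = ennreal (exp (- (s * ?l))) * emeasure (wait q i) A"
    unfolding wait_def by (subst nn_integral_cmult, simp, subst emeasure_density) auto
  finally show ?thesis .
qed

text \<open>Memorylessness: given that no clock in \<open>A\<close> rings up to time \<open>s\<close>, the residual clocks are distributed as the original ones.\<close>

definition elapse :: "nat set \<Rightarrow> real \<Rightarrow> (nat \<times> nat \<Rightarrow> real) \<Rightarrow> nat \<times> nat \<Rightarrow> real" where
  "elapse A s \<omega> = (\<lambda>(k, n). if n = 0 \<and> k \<in> A then \<omega> (k, 0) - s else \<omega> (k, n))"

lemma measurable_elapse [measurable]: "elapse A s \<in> measurable (clocks q) (clocks q)"
proof (rule measurable_clocksI)
  fix i
  show "(\<lambda>\<omega>. elapse A s \<omega> i) \<in> borel_measurable (clocks q)"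
    unfolding elapse_def by (cases i) simp
qed

text \<open>\<open>r\<close> is the total rate of the possibly infinitely many clocks in
  \<open>A\<close>. Requiring silence only of those below \<open>K\<close> gives a finite product,
  evaluated by \<open>emeasure_wait_shift\<close>; as \<open>K\<close> grows these events decrease
  to the desired one.\<close>

lemma emeasure_elapse_cylinder:
  assumes q: "0 < q" and s: "0 \<le> s" and r: "(\<lambda>k. if k \<in> A then q ^ k else 0) sums r"
    and J: "finite J" and X [measurable]: "\<And>i. i \<in> J \<Longrightarrow> X i \<in> sets borel"
  shows "emeasure (clocks q) {\<omega>. (\<forall>k\<in>A. s < \<omega> (k, 0)) \<and> (\<forall>i\<in>J. elapse A s \<omega> i \<in> X i)} =
    ennreal (exp (- (s * r))) * emeasure (clocks q) {\<omega>. \<forall>i\<in>J. \<omega> i \<in> X i}"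
proof -
  interpret prob_space "clocks q" using q by (rule prob_space_clocks)
  let ?c = "\<Prod>i\<in>J. emeasure (wait q i) (X i)"
  define B where "B K = {\<omega>. (\<forall>k<K. k \<in> A \<longrightarrow> s < \<omega> (k, 0)) \<and> (\<forall>i\<in>J. elapse A s \<omega> i \<in> X i)}" for K
  have B_sets: "B K \<in> sets (clocks q)" for K
  proof -
    have "Measurable.pred (clocks q) (\<lambda>\<omega>. elapse A s \<omega> i \<in> X i)" if "i \<in> J" for i
    proof -
      have "(\<lambda>\<omega>. elapse A s \<omega> i) \<in> borel_measurable (clocks q)" by measurable
      then show ?thesis using X[OF that] by (rule pred_sets2[rotated])
    qed
    then have "Measurable.pred (clocks q) (\<lambda>\<omega>. (\<forall>k<K. k \<in> A \<longrightarrow> s < \<omega> (k, 0)) \<and>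
        (\<forall>i\<in>J. elapse A s \<omega> i \<in> X i))"
      using J by (intro pred_intros_logic(3) pred_intros_finite(3)) measurable
    then show ?thesis unfolding B_def pred_def by simp
  qed
  have "decseq B" unfolding B_def by (auto simp: decseq_def)
  then have "(\<lambda>K. emeasure (clocks q) (B K)) \<longlonglongrightarrow> emeasure (clocks q) (\<Inter>K. B K)"
    using B_sets by (intro Lim_emeasure_decseq) auto
  moreover have "(\<Inter>K. B K) = {\<omega>. (\<forall>k\<in>A. s < \<omega> (k, 0)) \<and> (\<forall>i\<in>J. elapse A s \<omega> i \<in> X i)}"
    unfolding B_def by blast
  ultimately have lim: "(\<lambda>K. emeasure (clocks q) (B K)) \<longlonglongrightarrow>
      emeasure (clocks q) {\<omega>. (\<forall>k\<in>A. s < \<omega> (k, 0)) \<and> (\<forall>i\<in>J. elapse A s \<omega> i \<in> X i)}"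
    by simp
  \<comment> \<open>For \<open>K\<close> at least \<open>K0\<close>, every waiting time indexed by
    \<open>J\<close> that is shifted is also required to exceed \<open>s\<close>.\<close>
  obtain K0 where K0: "fst ` J \<subseteq> {..<K0}"
    using finite_nat_iff_bounded[of "fst ` J"] J by blast
  have box: "emeasure (clocks q) (B K) =
      ennreal (exp (- (s * (\<Sum>k<K. if k \<in> A then q ^ k else 0)))) * ?c" if K: "K0 \<le> K" for K
  proof -
    let ?I = "(\<lambda>k. (k, 0::nat)) ` {..<K}"
    let ?e = "\<lambda>i. if snd i = 0 \<and> fst i \<in> A then ennreal (exp (- (s * q ^ fst i))) else 1"
    let ?m = "\<lambda>i. if i \<in> J then emeasure (wait q i) (X i) else 1"
    define Z where "Z i = (if i \<in> J then X i else UNIV)" for i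
    \<comment> \<open>\<open>Y i\<close> collects all conditions on the single waiting time
      \<open>i\<close>, which exhibits \<open>B K\<close> as a cylinder over
      \<open>J \<union> ?I\<close>.\<close>
    define Y where "Y i = (if snd i = 0 \<and> fst i \<in> A then {x. s < x \<and> x - s \<in> Z i} else Z i)" for i
    have Z: "Z i \<in> sets borel" for i using X by (simp add: Z_def)
    have Z1: "emeasure (wait q i) (Z i) = ?m i" for i
      using prob_space.emeasure_space_1[OF prob_space_wait[OF q, of i]] by (simp add: Z_def)
    have Y: "Y i \<in> sets borel" for i
      unfolding Y_def using Z[of i] by auto
    have lt: "fst i < K" if "i \<in> J" for i using K0 K that by force
    have elapse: "elapse A s \<omega> i = (if snd i = 0 \<and> fst i \<in> A then \<omega> i - s else \<omega> i)" for \<omega> i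
      by (cases i) (auto simp: elapse_def)
    have "\<omega> \<in> B K \<longleftrightarrow> (\<forall>i\<in>J \<union> ?I. \<omega> i \<in> Y i)" for \<omega>
    proof
      assume *: "\<omega> \<in> B K"
      show "\<forall>i\<in>J \<union> ?I. \<omega> i \<in> Y i"
      proof
        fix i assume i: "i \<in> J \<union> ?I"
        then have "fst i < K" using lt[of i] by auto
        then show "\<omega> i \<in> Y i"
          using * i by (cases i) (auto simp: B_def Y_def Z_def elapse split: if_splits)
      qed
    next
      assume *: "\<forall>i\<in>J \<union> ?I. \<omega> i \<in> Y i"
      have "s < \<omega> (k, 0)" if "k < K" "k \<in> A" for k
        using * that bspec[OF *, of "(k, 0)"] by (auto simp: Y_def)
      moreover have "elapse A s \<omega> i \<in> X i" if "i \<in> J" for i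
        using bspec[OF *, of i] that by (auto simp: Y_def Z_def elapse split: if_splits)
      ultimately show "\<omega> \<in> B K" by (simp add: B_def)
    qed
    then have "B K = {\<omega>. \<forall>i\<in>J \<union> ?I. \<omega> i \<in> Y i}" by blast
    then have "emeasure (clocks q) (B K) = (\<Prod>i\<in>J \<union> ?I. emeasure (wait q i) (Y i))"
      using emeasure_clocks_cylinder[OF q, of "J \<union> ?I" Y] Y J by simp
    also have "\<dots> = (\<Prod>i\<in>J \<union> ?I. ?e i * ?m i)"
      using Z1 emeasure_wait_shift[OF q s Z] by (intro prod.cong refl) (auto simp: Y_def)
    also have "\<dots> = (\<Prod>i\<in>J \<union> ?I. ?e i) * (\<Prod>i\<in>J \<union> ?I. ?m i)"
      by (rule prod.distrib)
    also have "(\<Prod>i\<in>J \<union> ?I. ?m i) = ?c"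
      using J by (intro prod.mono_neutral_cong_right) auto
    also have "(\<Prod>i\<in>J \<union> ?I. ?e i) = (\<Prod>i\<in>?I. ?e i)"
      using J lt by (intro prod.mono_neutral_right) (auto simp: image_iff prod_eq_iff)
    also have "\<dots> = (\<Prod>k<K. ennreal (exp (- (s * (if k \<in> A then q ^ k else 0)))))"
      by (subst prod.reindex) (auto simp: inj_on_def intro!: prod.cong)
    also have "\<dots> = ennreal (exp (- (s * (\<Sum>k<K. if k \<in> A then q ^ k else 0))))"
      by (subst prod_ennreal) (auto simp: exp_sum[symmetric] sum_negf sum_distrib_left)
    finally show ?thesis .
  qed
  have "?c \<noteq> \<infinity>"
    using emeasure_clocks_cylinder[OF q J X] emeasure_finite[of "{\<omega>. \<forall>i\<in>J. \<omega> i \<in> X i}"] by simp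
  then have "?c < top" by (simp add: less_top)
  moreover have "(\<lambda>K. \<Sum>k<K. if k \<in> A then q ^ k else 0) \<longlonglongrightarrow> r" using r by (simp add: sums_def)
  then have "(\<lambda>K. ennreal (exp (- (s * (\<Sum>k<K. if k \<in> A then q ^ k else 0))))) \<longlonglongrightarrow>
      ennreal (exp (- (s * r)))"
    by (intro tendsto_intros)
  ultimately have "(\<lambda>K. ?c * ennreal (exp (- (s * (\<Sum>k<K. if k \<in> A then q ^ k else 0))))) \<longlonglongrightarrow>
      ?c * ennreal (exp (- (s * r)))"
    by (rule ennreal_tendsto_cmult)
  moreover have "\<forall>\<^sub>F K in sequentially. ?c * ennreal (exp (- (s * (\<Sum>k<K. if k \<in> A then q ^ k else 0)))) =
      emeasure (clocks q) (B K)"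
    using eventually_ge_at_top[of K0] by eventually_elim (simp add: box mult.commute)
  ultimately have "(\<lambda>K. emeasure (clocks q) (B K)) \<longlonglongrightarrow> ?c * ennreal (exp (- (s * r)))"
    by (rule Lim_transform_eventually)
  then show ?thesis
    using LIMSEQ_unique[OF lim] emeasure_clocks_cylinder[OF q J X] by (simp add: mult.commute)
qed

text \<open>Both sides integrate \<open>g\<close> against finite measures that agree on cylinders by
  \<open>emeasure_elapse_cylinder\<close>, and cylinders determine a finite measure on the product
  space.\<close>

lemma nn_integral_elapse:
  assumes q: "0 < q" and s: "0 \<le> s" and r: "(\<lambda>k. if k \<in> A then q ^ k else 0) sums r"
    and g [measurable]: "g \<in> borel_measurable (clocks q)"
  shows "(\<integral>\<^sup>+\<omega>. indicator {\<omega>. \<forall>k\<in>A. s < \<omega> (k, 0)} \<omega> * g (elapse A s \<omega>) \<partial>clocks q) =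
    ennreal (exp (- (s * r))) * (\<integral>\<^sup>+\<omega>. g \<omega> \<partial>clocks q)"
proof -
  interpret prob_space "clocks q" using q by (rule prob_space_clocks)
  let ?E = "{\<omega>. \<forall>k\<in>A. s < \<omega> (k, 0)} :: (nat \<times> nat \<Rightarrow> real) set"
  have "Measurable.pred (clocks q) (\<lambda>\<omega>. \<forall>k\<in>A. s < \<omega> (k, 0))"
    by (intro pred_intros_countable_bounded) measurable
  then have E [measurable]: "?E \<in> sets (clocks q)" by (simp add: pred_def)
  let ?P = "distr (density (clocks q) (indicator ?E)) (clocks q) (elapse A s)"
  let ?Q = "density (clocks q) (\<lambda>_. ennreal (exp (- (s * r))))"
  have m: "elapse A s \<in> measurable (density (clocks q) (indicator ?E)) (clocks q)"
    by measurable
  have P: "emeasure ?P C = emeasure (clocks q) (?E \<inter> elapse A s -` C)" if C: "C \<in> sets (clocks q)" for C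
  proof -
    have C': "elapse A s -` C \<in> sets (clocks q)"
      using measurable_sets[OF measurable_elapse C, of A s] by simp
    have "emeasure ?P C = emeasure (density (clocks q) (indicator ?E)) (elapse A s -` C)"
      by (subst emeasure_distr[OF m C]) simp
    also have "\<dots> = (\<integral>\<^sup>+\<omega>. indicator (?E \<inter> elapse A s -` C) \<omega> \<partial>clocks q)"
      using C' by (simp add: emeasure_density indicator_inter_arith)
    also have "\<dots> = emeasure (clocks q) (?E \<inter> elapse A s -` C)"
      using C' E by (intro nn_integral_indicator) auto
    finally show ?thesis .
  qed
  have "?P = ?Q"
  proof (rule measure_eqI_PiM_infinite[where I = UNIV and M = "wait q"])
    show "sets ?P = sets (PiM UNIV (wait q))" "sets ?Q = sets (PiM UNIV (wait q))"
      by (simp_all add: clocks_eq)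
    have "UNIV \<in> sets (clocks q)" using sets.top[of "clocks q"] by simp
    then have "emeasure ?P UNIV \<noteq> \<infinity>" using P[of UNIV] emeasure_finite[of "?E"] by simp
    then show "finite_measure ?P" by (intro finite_measureI) simp
  next
    fix X and J :: "(nat \<times> nat) set"
    assume J: "finite J" and X: "\<And>i. i \<in> J \<Longrightarrow> X i \<in> sets (wait q i)"
    then have X': "\<And>i. i \<in> J \<Longrightarrow> X i \<in> sets borel" by simp
    have C: "prod_emb UNIV (wait q) J (Pi\<^sub>E J X) = {\<omega>. \<forall>i\<in>J. \<omega> i \<in> X i}" (is "?C = _")
      by (auto simp: prod_emb_def space_PiM PiE_iff restrict_def)
    have CS: "?C \<in> sets (clocks q)"
      unfolding clocks_eq using J X by (intro sets_PiM_I) auto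
    have "?E \<inter> elapse A s -` ?C = {\<omega>. (\<forall>k\<in>A. s < \<omega> (k, 0)) \<and> (\<forall>i\<in>J. elapse A s \<omega> i \<in> X i)}"
      unfolding C by auto
    then show "emeasure ?P ?C = emeasure ?Q ?C"
      unfolding P[OF CS] using CS emeasure_elapse_cylinder[OF q s r J X']
      by (simp add: emeasure_density_const C)
  qed
  then have "(\<integral>\<^sup>+\<omega>. g \<omega> \<partial>?P) = (\<integral>\<^sup>+\<omega>. g \<omega> \<partial>?Q)" by simp
  then show ?thesis
    using m by (simp add: nn_integral_distr nn_integral_density nn_integral_cmult)
qed

definition prepend :: "nat \<Rightarrow> real \<Rightarrow> (nat \<times> nat \<Rightarrow> real) \<Rightarrow> nat \<times> nat \<Rightarrow> real" where
  "prepend j s \<omega> = (\<lambda>(k, n). if k = j then case n of 0 \<Rightarrow> s | Suc m \<Rightarrow> \<omega> (j, m) else \<omega> (k, n))"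

text \<open>The waiting time \<open>(j, 0)\<close> is independent of the others. These have again
  the law of the clocks once those of clock \<open>j\<close> are renumbered, since the rate depends
  on the clock only.\<close>

lemma nn_integral_prepend:
  assumes q: "0 < q" and h [measurable]: "h \<in> borel_measurable (clocks q)"
  shows "(\<integral>\<^sup>+\<omega>. h \<omega> \<partial>clocks q) =
    (\<integral>\<^sup>+s. \<integral>\<^sup>+\<omega>. h (prepend j s \<omega>) \<partial>clocks q \<partial>wait q (j, 0))"
proof -
  let ?I = "UNIV - {(j, 0::nat)}"
  let ?f = "\<lambda>(k, n). if k = j then (k, n - 1) else (k, n :: nat)"
  let ?u = "\<lambda>(s, X). X((j, 0) := s) :: nat \<times> nat \<Rightarrow> real"
  have ins: "insert (j, 0) ?I = UNIV" by auto
  have f: "wait q (?f i) = wait q i" for i by (cases i) (simp add: wait_def)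
  have 1: "distr (wait q (j, 0) \<Otimes>\<^sub>M PiM ?I (wait q)) (clocks q) ?u = clocks q"
    using distr_pair_PiM_eq_PiM[of ?I "wait q" "(j, 0)"] prob_space_wait[OF q]
    by (simp add: ins clocks_eq)
  have 2: "distr (clocks q) (PiM ?I (wait q)) (\<lambda>\<omega>. \<lambda>i\<in>?I. \<omega> (?f i)) = PiM ?I (wait q)"
  proof -
    have "inj_on ?f ?I"
      by (auto simp: inj_on_def split: if_splits)
    then show ?thesis
      using distr_PiM_reindex[of UNIV "wait q" ?f ?I] prob_space_wait[OF q] by (simp add: f clocks_eq)
  qed
  have u [measurable]: "?u \<in> measurable (wait q (j, 0) \<Otimes>\<^sub>M PiM ?I (wait q)) (clocks q)"
    unfolding clocks_eq using measurable_fun_upd[of UNIV ?I "(j, 0)" snd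
        "wait q (j, 0) \<Otimes>\<^sub>M PiM ?I (wait q)" "wait q" fst]
    by (simp add: ins case_prod_beta')
  have v [measurable]: "(\<lambda>\<omega>. \<lambda>i\<in>?I. \<omega> (?f i)) \<in> measurable (clocks q) (PiM ?I (wait q))"
    by (intro measurable_restrict) (simp add: measurable_cong_sets[OF refl sets_wait])
  interpret I: prob_space "PiM ?I (wait q)" by (intro prob_space_PiM prob_space_wait q)
  have "(\<integral>\<^sup>+\<omega>. h \<omega> \<partial>clocks q) = (\<integral>\<^sup>+x. h (?u x) \<partial>(wait q (j, 0) \<Otimes>\<^sub>M PiM ?I (wait q)))"
    by (subst 1[symmetric], subst nn_integral_distr) (use u in auto)
  also have "\<dots> = (\<integral>\<^sup>+s. \<integral>\<^sup>+X. h (X((j, 0) := s)) \<partial>PiM ?I (wait q) \<partial>wait q (j, 0))"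
    by (subst I.nn_integral_fst[symmetric]) (use measurable_compose[OF u h] in auto)
  also have "\<dots> = (\<integral>\<^sup>+s. \<integral>\<^sup>+\<omega>. h (prepend j s \<omega>) \<partial>clocks q \<partial>wait q (j, 0))"
  proof (intro nn_integral_cong)
    fix s :: real
    have s: "(\<lambda>X. X((j, 0) := s)) \<in> measurable (PiM ?I (wait q)) (clocks q)"
      using measurable_compose[OF measurable_Pair1' u, of s] by simp
    have eq: "(\<lambda>i\<in>?I. \<omega> (?f i))((j, 0) := s) = prepend j s \<omega>" for \<omega>
      by (auto simp: prepend_def fun_eq_iff split: nat.splits)
    have "(\<integral>\<^sup>+X. h (X((j, 0) := s)) \<partial>PiM ?I (wait q)) =
        (\<integral>\<^sup>+X. h (X((j, 0) := s)) \<partial>distr (clocks q) (PiM ?I (wait q)) (\<lambda>\<omega>. \<lambda>i\<in>?I. \<omega> (?f i)))"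
      unfolding 2 ..
    also have "\<dots> = (\<integral>\<^sup>+\<omega>. h (prepend j s \<omega>) \<partial>clocks q)"
      by (subst nn_integral_distr[OF v]) (use measurable_compose[OF s h] in \<open>simp_all add: eq\<close>)
    finally show "(\<integral>\<^sup>+X. h (X((j, 0) := s)) \<partial>PiM ?I (wait q)) = (\<integral>\<^sup>+\<omega>. h (prepend j s \<omega>) \<partial>clocks q)" .
  qed
  finally show ?thesis .
qed

section \<open>The law of the ringing clocks\<close>

definition tick :: "nat \<Rightarrow> (nat \<times> nat \<Rightarrow> real) \<Rightarrow> nat \<times> nat \<Rightarrow> real" where
  "tick j \<omega> = (\<lambda>(k, n). if k = j then \<omega> (j, Suc n) else if n = 0 then \<omega> (k, 0) - \<omega> (j, 0) else \<omega> (k, n))"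

text \<open>
  For positive waiting times, \<open>rings_in_order w t\<close> says that the clocks ringing up to time \<open>t\<close>
  are, in strict chronological order, those listed in \<open>w\<close>; \<open>tick j\<close> restarts time at the first
  ring, which is that of clock \<open>j\<close>.
\<close>

primrec rings_in_order :: "nat list \<Rightarrow> real \<Rightarrow> (nat \<times> nat \<Rightarrow> real) \<Rightarrow> bool" where
  "rings_in_order [] t \<omega> \<longleftrightarrow> (\<forall>k. t < \<omega> (k, 0))"
| "rings_in_order (j # w) t \<omega> \<longleftrightarrow> \<omega> (j, 0) \<le> t \<and> (\<forall>k\<in>- {j}. \<omega> (j, 0) < \<omega> (k, 0)) \<and>
     rings_in_order w (t - \<omega> (j, 0)) (tick j \<omega>)"

lemma measurable_tick [measurable]: "tick j \<in> measurable (clocks q) (clocks q)"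
proof (rule measurable_clocksI)
  fix i
  show "(\<lambda>\<omega>. tick j \<omega> i) \<in> borel_measurable (clocks q)"
    unfolding tick_def by (cases i) simp
qed

text \<open>Measurability is joint in time and clocks because the recursion evaluates the rest of
  the word at the random time \<open>t - \<omega> (j, 0)\<close>.\<close>

lemma measurable_rings_in_order:
  "Measurable.pred (borel \<Otimes>\<^sub>M clocks q) (\<lambda>(t, \<omega>). rings_in_order w t \<omega>)"
proof (induction w)
  case Nil
  then show ?case unfolding case_prod_beta' rings_in_order.simps by measurable
next
  case (Cons j w)
  have "(\<lambda>(t, \<omega>). (t - \<omega> (j, 0), tick j \<omega>)) \<in> measurable (borel \<Otimes>\<^sub>M clocks q) (borel \<Otimes>\<^sub>M clocks q)"
    unfolding case_prod_beta' by measurable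
  from measurable_compose[OF this Cons]
  have "Measurable.pred (borel \<Otimes>\<^sub>M clocks q) (\<lambda>(t, \<omega>). rings_in_order w (t - \<omega> (j, 0)) (tick j \<omega>))"
    by (simp add: case_prod_beta')
  moreover have "Measurable.pred (borel \<Otimes>\<^sub>M clocks q) (\<lambda>(t, \<omega>). \<omega> (j, 0) \<le> t)"
    unfolding case_prod_beta' by measurable
  moreover have "Measurable.pred (borel \<Otimes>\<^sub>M clocks q) (\<lambda>(t, \<omega>). \<forall>k\<in>- {j}. \<omega> (j, 0) < \<omega> (k, 0))"
    unfolding case_prod_beta' by (intro pred_intros_countable_bounded) measurable
  ultimately show ?case
    unfolding case_prod_beta' rings_in_order.simps by (intro pred_intros_logic)
qed

lemma sets_rings_in_order [measurable]: "{\<omega>. rings_in_order w t \<omega>} \<in> sets (clocks q)"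
proof -
  have "Pair t \<in> measurable (clocks q) (borel \<Otimes>\<^sub>M clocks q)" by simp
  from measurable_compose[OF this measurable_rings_in_order] show ?thesis
    by (simp add: pred_def)
qed

text \<open>Restarting after the prepended ring leaves clock \<open>j\<close> fresh and the other
  clocks aged by \<open>s\<close>, which is the situation of \<open>nn_integral_elapse\<close> with
  \<open>A = - {j}\<close>.\<close>

lemma rings_in_order_prepend:
  "rings_in_order (j # w) t (prepend j s \<omega>) \<longleftrightarrow>
     s \<le> t \<and> (\<forall>k\<in>- {j}. s < \<omega> (k, 0)) \<and> rings_in_order w (t - s) (elapse (- {j}) s \<omega>)"
proof -
  have "tick j (prepend j s \<omega>) = elapse (- {j}) s \<omega>"
    by (auto simp: tick_def prepend_def elapse_def fun_eq_iff)
  then show ?thesis by (simp add: prepend_def)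
qed

lemma sums_rates_except:
  fixes q :: real
  assumes "0 < q" "q < 1"
  shows "(\<lambda>k. if k \<in> - {j} then q ^ k else 0) sums (1 / (1 - q) - q ^ j)"
proof -
  have "(\<lambda>k. q ^ k - (if k = j then q ^ k else 0)) sums (1 / (1 - q) - q ^ j)"
    using assms by (intro sums_diff geometric_sums sums_single[of j "\<lambda>k. q ^ k"]) auto
  moreover have "(\<lambda>k. q ^ k - (if k = j then q ^ k else 0)) = (\<lambda>k. if k \<in> - {j} then q ^ k else 0)"
    by auto
  ultimately show ?thesis by simp
qed

text \<open>Condition on the time \<open>s\<close> of the first ring, by clock \<open>j\<close>. The
  density of \<open>s\<close>, the probability that the other clocks are silent up to
  \<open>s\<close>, and the exponential factor for the remaining time \<open>t - s\<close> multiply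
  to \<open>q ^ j * exp (- (t / (1 - q)))\<close> for every \<open>s\<close>. It remains to
  integrate a power of \<open>t - s\<close>.\<close>

lemma emeasure_rings_in_order:
  assumes q: "0 < q" "q < 1"
  shows "0 \<le> t \<Longrightarrow> emeasure (clocks q) {\<omega>. rings_in_order w t \<omega>} =
    ennreal (exp (- (t / (1 - q))) * (\<Prod>k\<leftarrow>w. q ^ k) * (t ^ length w / fact (length w)))"
proof (induction w arbitrary: t)
  case Nil
  interpret prob_space "clocks q" using q(1) by (rule prob_space_clocks)
  have "(\<lambda>k. if k \<in> UNIV then q ^ k else 0) sums (1 / (1 - q))"
    using q geometric_sums[of q] by simp
  \<comment> \<open>With all clocks in \<open>A\<close> and no cylinder condition, this is the event
    that no clock rings up to \<open>t\<close>.\<close>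
  from emeasure_elapse_cylinder[OF q(1) Nil this, of "{}"]
  show ?case using emeasure_space_1 by simp
next
  case (Cons j w)
  let ?n = "length w" and ?w = "\<Prod>k\<leftarrow>w. q ^ k" and ?R = "1 / (1 - q)"
  let ?S = "\<lambda>w t. {\<omega>. rings_in_order w t \<omega>}"
  let ?c = "q ^ j * exp (- (t * ?R)) * ?w"
  have w: "0 \<le> ?w" using q by (intro prod_list_nonneg) auto
  have "emeasure (clocks q) (?S (j # w) t) = (\<integral>\<^sup>+\<omega>. indicator (?S (j # w) t) \<omega> \<partial>clocks q)"
    by (rule nn_integral_indicator[symmetric]) measurable
  also have "\<dots> = (\<integral>\<^sup>+s. \<integral>\<^sup>+\<omega>. indicator (?S (j # w) t) (prepend j s \<omega>) \<partial>clocks q \<partial>wait q (j, 0))"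
    by (rule nn_integral_prepend[OF q(1)]) measurable
  also have "\<dots> = (\<integral>\<^sup>+s. ennreal (exponential_density (q ^ j) s) *
      (\<integral>\<^sup>+\<omega>. indicator (?S (j # w) t) (prepend j s \<omega>) \<partial>clocks q) \<partial>lborel)"
  proof -
    interpret prob_space "clocks q" using q(1) by (rule prob_space_clocks)
    have "Measurable.pred (borel \<Otimes>\<^sub>M clocks q) (\<lambda>x. rings_in_order (j # w) t (prepend j (fst x) (snd x)))"
    proof -
      have "(\<lambda>x. (t, prepend j (fst x) (snd x))) \<in> measurable (borel \<Otimes>\<^sub>M clocks q) (borel \<Otimes>\<^sub>M clocks q)"
      proof (intro measurable_Pair measurable_const measurable_clocksI)
        fix i :: "nat \<times> nat"
        obtain k n where i: "i = (k, n)" by (cases i)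
        show "(\<lambda>x. prepend j (fst x) (snd x) i) \<in> borel_measurable (borel \<Otimes>\<^sub>M clocks q)"
          unfolding prepend_def i by (cases n) auto
      qed simp
      from measurable_compose[OF this measurable_rings_in_order, of "j # w"] show ?thesis
        by (simp del: rings_in_order.simps)
    qed
    then have "(\<lambda>x. indicator (?S (j # w) t) (prepend j (fst x) (snd x)) :: ennreal)
        \<in> borel_measurable (borel \<Otimes>\<^sub>M clocks q)"
      by (auto simp: indicator_def)
    then have "(\<lambda>s. \<integral>\<^sup>+\<omega>. indicator (?S (j # w) t) (prepend j s \<omega>) \<partial>clocks q) \<in> borel_measurable borel"
      by (intro borel_measurable_nn_integral) (simp add: case_prod_beta' del: rings_in_order.simps)
    then show ?thesis unfolding wait_def by (subst nn_integral_density) (auto simp del: rings_in_order.simps)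
  qed
  also have "\<dots> = (\<integral>\<^sup>+s. ennreal (?c * ((t - s) ^ ?n / fact ?n)) * indicator {0..t} s \<partial>lborel)"
  proof (intro nn_integral_cong)
    fix s :: real
    consider "s < 0" | "t < s" | "0 \<le> s" "s \<le> t" by linarith
    then show "ennreal (exponential_density (q ^ j) s) *
        (\<integral>\<^sup>+\<omega>. indicator (?S (j # w) t) (prepend j s \<omega>) \<partial>clocks q) =
        ennreal (?c * ((t - s) ^ ?n / fact ?n)) * indicator {0..t} s"
    proof cases
      case 1
      then show ?thesis by (simp add: exponential_density_def)
    next
      case 2
      then have "indicator (?S (j # w) t) (prepend j s \<omega>) = (0::ennreal)" for \<omega>
        by (simp add: rings_in_order_prepend del: rings_in_order.simps)
      then show ?thesis using 2 by simp
    next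
      case 3
      have "(\<integral>\<^sup>+\<omega>. indicator (?S (j # w) t) (prepend j s \<omega>) \<partial>clocks q) =
          (\<integral>\<^sup>+\<omega>. indicator {\<omega>. \<forall>k\<in>- {j}. s < \<omega> (k, 0)} \<omega> *
            indicator (?S w (t - s)) (elapse (- {j}) s \<omega>) \<partial>clocks q)"
        using 3 by (intro nn_integral_cong)
          (auto simp: rings_in_order_prepend indicator_def simp del: rings_in_order.simps)
      also have "\<dots> = ennreal (exp (- (s * (?R - q ^ j)))) *
          (\<integral>\<^sup>+\<omega>. indicator (?S w (t - s)) \<omega> \<partial>clocks q)"
        using 3 q by (intro nn_integral_elapse sums_rates_except) measurable
      also have "(\<integral>\<^sup>+\<omega>. indicator (?S w (t - s)) \<omega> \<partial>clocks q) = emeasure (clocks q) (?S w (t - s))"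
        by (rule nn_integral_indicator) measurable
      also have "\<dots> = ennreal (exp (- ((t - s) / (1 - q))) * ?w * ((t - s) ^ ?n / fact ?n))"
        using 3 by (intro Cons.IH) simp
      finally have inner: "(\<integral>\<^sup>+\<omega>. indicator (?S (j # w) t) (prepend j s \<omega>) \<partial>clocks q) =
          ennreal (exp (- (s * (?R - q ^ j)))) *
          ennreal (exp (- ((t - s) / (1 - q))) * ?w * ((t - s) ^ ?n / fact ?n))" .
      have mult3: "ennreal a * (ennreal b * ennreal c) = ennreal (a * (b * c))"
        if "0 \<le> a" "0 \<le> b" "0 \<le> c" for a b c :: real
        using that by (simp add: ennreal_mult)
      have dens: "exponential_density (q ^ j) s = q ^ j * exp (- (s * q ^ j))"
        using 3 by (simp add: exponential_density_def)
      have "ennreal (exponential_density (q ^ j) s) *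
          (\<integral>\<^sup>+\<omega>. indicator (?S (j # w) t) (prepend j s \<omega>) \<partial>clocks q) =
          ennreal ((q ^ j * exp (- (s * q ^ j))) * (exp (- (s * (?R - q ^ j))) *
            (exp (- ((t - s) / (1 - q))) * ?w * ((t - s) ^ ?n / fact ?n))))"
        unfolding inner dens using 3 q w by (intro mult3 mult_nonneg_nonneg) auto
      also have "(q ^ j * exp (- (s * q ^ j))) * (exp (- (s * (?R - q ^ j))) *
            (exp (- ((t - s) / (1 - q))) * ?w * ((t - s) ^ ?n / fact ?n))) =
          q ^ j * (exp (- (s * q ^ j)) * exp (- (s * (?R - q ^ j))) * exp (- ((t - s) / (1 - q)))) *
            ?w * ((t - s) ^ ?n / fact ?n)"
        by (simp only: ac_simps)
      also have "exp (- (s * q ^ j)) * exp (- (s * (?R - q ^ j))) * exp (- ((t - s) / (1 - q))) =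
          exp (- (t * ?R))"
        by (simp add: exp_add[symmetric] algebra_simps diff_divide_distrib)
      finally show ?thesis using 3 by simp
    qed
  qed
  also have "\<dots> = ennreal (?c * (- ((t - t) ^ Suc ?n / fact (Suc ?n))) -
      ?c * (- ((t - 0) ^ Suc ?n / fact (Suc ?n))))"
  proof (rule nn_integral_FTC_Icc)
    fix s assume s: "s \<in> {0..t}"
    show "0 \<le> ?c * ((t - s) ^ ?n / fact ?n)" using s q w by (intro mult_nonneg_nonneg) auto
    have "((\<lambda>s. t - s) has_real_derivative -1) (at s)"
      by (auto intro!: derivative_eq_intros)
    from DERIV_minus[OF DERIV_cdivide[OF DERIV_power[OF this, of "Suc ?n"], of "fact (Suc ?n)"]]
    have "((\<lambda>s. - ((t - s) ^ Suc ?n / fact (Suc ?n))) has_real_derivative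
        - (of_nat (Suc ?n) * (- 1 * (t - s) ^ ?n) / fact (Suc ?n))) (at s)"
      by (simp only: diff_Suc_Suc diff_zero)
    also have "- (of_nat (Suc ?n) * (- 1 * (t - s) ^ ?n) / fact (Suc ?n)) = (t - s) ^ ?n / fact ?n"
      by (simp add: fact_Suc del: of_nat_Suc)
    finally show "((\<lambda>s. ?c * (- ((t - s) ^ Suc ?n / fact (Suc ?n)))) has_real_derivative
        ?c * ((t - s) ^ ?n / fact ?n)) (at s)"
      by (rule DERIV_cmult)
  qed (use Cons.prems in auto)
  also have "?c * (- ((t - t) ^ Suc ?n / fact (Suc ?n))) - ?c * (- ((t - 0) ^ Suc ?n / fact (Suc ?n))) =
      exp (- (t / (1 - q))) * (\<Prod>k\<leftarrow>j # w. q ^ k) * (t ^ length (j # w) / fact (length (j # w)))"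
    by simp
  finally show ?case .
qed

section \<open>Reading the word of ringing labels off the clocks\<close>

lemma ring_time_tick:
  "ring_time (tick j \<omega>) k n = ring_time \<omega> k (if k = j then Suc n else n) - \<omega> (j, 0)"
  by (induction n) (auto simp: ring_time_def tick_def)

lemma ring_time_ge_first:
  assumes "\<And>i. 0 < \<omega> i"
  shows "\<omega> (k, 0) \<le> ring_time \<omega> k n"
  by (induction n) (use assms in \<open>auto simp: ring_time_def intro: order_trans[OF _ add_increasing2] less_imp_le\<close>)

text \<open>After the first ring, at \<open>\<omega> (j, 0)\<close>, the ring times are those of
  \<open>tick j \<omega>\<close> delayed by this amount. Positivity passes to
  \<open>tick j \<omega>\<close> and puts them all strictly later, so the sorted list of times has
  the first ring as its head.\<close>

lemma word_if_rings_in_order: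
  assumes "rings_in_order w t \<omega>" "\<And>i. 0 < \<omega> i"
  shows "finite (rings_upto t \<omega>) \<and> map (ringing \<omega>) (sorted_list_of_set (rings_upto t \<omega>)) = w"
  using assms
proof (induction w arbitrary: t \<omega>)
  case Nil
  have "t < ring_time \<omega> k n" for k n
    using Nil ring_time_ge_first[of \<omega> k n] by (auto intro: less_le_trans)
  then have "\<not> ring_time \<omega> k n \<le> t" for k n by (simp add: not_le)
  then have "rings_upto t \<omega> = {}" by (auto simp: rings_upto_def)
  then show ?case by simp
next
  case (Cons j w)
  let ?s = "\<omega> (j, 0)" and ?\<omega> = "tick j \<omega>"
  have first: "?s \<le> t" "\<And>k. k \<noteq> j \<Longrightarrow> ?s < \<omega> (k, 0)" and rest: "rings_in_order w (t - ?s) ?\<omega>"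
    using Cons.prems(1) by auto
  have pos: "0 < ?\<omega> i" for i
    using Cons.prems(2) first(2) by (cases i) (auto simp: tick_def)
  have rpos: "0 < ring_time ?\<omega> k n" for k n
    using pos ring_time_ge_first[of ?\<omega> k n] by (auto intro: less_le_trans)
  have IH: "finite (rings_upto (t - ?s) ?\<omega>)"
    "map (ringing ?\<omega>) (sorted_list_of_set (rings_upto (t - ?s) ?\<omega>)) = w"
    using Cons.IH[OF rest pos] by auto
  have times: "(\<exists>n. r = ring_time \<omega> k n) \<longleftrightarrow> k = j \<and> r = ?s \<or> (\<exists>n. r - ?s = ring_time ?\<omega> k n)" for r k
  proof
    assume "\<exists>n. r = ring_time \<omega> k n"
    then obtain n where n: "r = ring_time \<omega> k n" ..
    show "k = j \<and> r = ?s \<or> (\<exists>n. r - ?s = ring_time ?\<omega> k n)"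
    proof (cases "k = j")
      case False
      then show ?thesis using n by (auto simp: ring_time_tick)
    next
      case True
      then show ?thesis using n by (cases n) (auto simp: ring_time_tick ring_time_def[of _ _ 0])
    qed
  next
    assume "k = j \<and> r = ?s \<or> (\<exists>n. r - ?s = ring_time ?\<omega> k n)"
    then show "\<exists>n. r = ring_time \<omega> k n"
    proof (elim disjE conjE exE)
      assume "k = j" "r = ?s"
      then show ?thesis by (auto simp: ring_time_def intro!: exI[of _ "0::nat"])
    next
      fix n assume "r - ?s = ring_time ?\<omega> k n"
      then show ?thesis by (auto simp: ring_time_tick)
    qed
  qed
  have set: "rings_upto t \<omega> = insert ?s ((+) ?s ` rings_upto (t - ?s) ?\<omega>)" (is "_ = insert _ ?B")
  proof (rule set_eqI)
    fix r
    have "r \<in> rings_upto t \<omega> \<longleftrightarrow> r \<le> t \<and> (r = ?s \<or> (\<exists>k n. r - ?s = ring_time ?\<omega> k n))"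
      unfolding rings_upto_def mem_Collect_eq times by blast
    moreover have "r \<in> ?B \<longleftrightarrow> r - ?s \<in> rings_upto (t - ?s) ?\<omega>"
      by (auto simp: image_iff intro!: bexI[of _ "r - ?s"])
    ultimately show "r \<in> rings_upto t \<omega> \<longleftrightarrow> r \<in> insert ?s ?B"
      using first(1) by (auto simp: rings_upto_def)
  qed
  have fin: "finite ?B" using IH(1) by simp
  have above: "?s < r" if "r \<in> ?B" for r
    using that rpos by (auto simp: rings_upto_def)
  have B: "sorted_list_of_set ?B = map ((+) ?s) (sorted_list_of_set (rings_upto (t - ?s) ?\<omega>))"
    (is "_ = ?l")
  proof -
    have "sorted_wrt (<) ?l"
      unfolding sorted_wrt_map by simp
    then have "sorted_list_of_set (set ?l) = ?l"
      by (intro sorted_list_of_set.idem_if_sorted_distinct) (auto simp: strict_sorted_iff)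
    then show ?thesis using IH(1) by simp
  qed
  have "sorted_list_of_set (rings_upto t \<omega>) = ?s # sorted_list_of_set ?B"
    unfolding set
  proof -
    have "sorted_wrt (<) (?s # sorted_list_of_set ?B)"
      using above fin by auto
    then have "sorted_list_of_set (set (?s # sorted_list_of_set ?B)) = ?s # sorted_list_of_set ?B"
      by (intro sorted_list_of_set.idem_if_sorted_distinct) (auto simp: strict_sorted_iff)
    then show "sorted_list_of_set (insert ?s ?B) = ?s # sorted_list_of_set ?B"
      using fin by simp
  qed
  moreover have "ringing \<omega> ?s = j"
  proof -
    have "(\<exists>n. ?s = ring_time \<omega> k n) \<longleftrightarrow> k = j" for k
      unfolding times using rpos[of k] by (auto simp: less_le)
    then show ?thesis by (auto simp: ringing_def intro: Least_equality)
  qed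
  moreover have "ringing \<omega> (?s + r) = ringing ?\<omega> r" if "r \<in> rings_upto (t - ?s) ?\<omega>" for r
  proof -
    have "0 < r" using that rpos by (auto simp: rings_upto_def)
    then show ?thesis unfolding ringing_def times by simp
  qed
  then have "map (\<lambda>r. ringing \<omega> (?s + r)) (sorted_list_of_set (rings_upto (t - ?s) ?\<omega>)) = w"
    using IH by (subst map_cong[OF refl, where g = "ringing ?\<omega>"]) auto
  ultimately have "map (ringing \<omega>) (sorted_list_of_set (rings_upto t \<omega>)) = j # w"
    by (simp add: B o_def)
  then show ?case using fin set by simp
qed

section \<open>TASEP as the uniformized chain run for a Poisson number of steps\<close>

definition words :: "real \<Rightarrow> real \<Rightarrow> nat list pmf" where
  "words q t = bind_pmf (count_pmf (t / (1 - q))) (\<lambda>n. replicate_pmf n (geometric_pmf (1 - q)))"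

lemma pmf_replicate:
  "pmf (replicate_pmf n p) w = (if length w = n then \<Prod>k\<leftarrow>w. pmf p k else 0)"
proof (induction n arbitrary: w)
  case 0
  then show ?case by (auto simp: pmf_return)
next
  case (Suc n)
  have eq: "replicate_pmf (Suc n) p = map_pmf (\<lambda>(x, xs). x # xs) (pair_pmf p (replicate_pmf n p))"
    by (simp add: map_pmf_def pair_pmf_def bind_assoc_pmf bind_return_pmf)
  show ?case
  proof (cases w)
    case Nil
    then show ?thesis unfolding eq by (auto simp: pmf_eq_0_set_pmf)
  next
    case (Cons a v)
    have "pmf (map_pmf (\<lambda>(x, xs). x # xs) (pair_pmf p (replicate_pmf n p))) ((\<lambda>(x, xs). x # xs) (a, v)) =
        pmf (pair_pmf p (replicate_pmf n p)) (a, v)"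
      by (rule pmf_map_inj') (auto simp: inj_on_def)
    then show ?thesis unfolding eq using Cons Suc.IH[of v] by (simp add: pmf_pair)
  qed
qed

text \<open>The normalization \<open>1 - q\<close> of each geometric weight cancels the total rate
  \<open>1 / (1 - q)\<close> in the Poisson mean; what remains is the probability in
  \<open>emeasure_rings_in_order\<close>.\<close>

lemma pmf_words:
  assumes q: "0 < q" "q < 1" and t: "0 \<le> t"
  shows "pmf (words q t) w =
    exp (- (t / (1 - q))) * (\<Prod>k\<leftarrow>w. q ^ k) * (t ^ length w / fact (length w))"
proof -
  let ?n = "length w"
  have geo: "pmf (geometric_pmf (1 - q)) = (\<lambda>k. q ^ k * (1 - q))" using q by auto
  have "pmf (words q t) w =
      (\<integral>n. pmf (replicate_pmf n (geometric_pmf (1 - q))) w \<partial>count_pmf (t / (1 - q)))"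
    unfolding words_def by (rule pmf_bind)
  also have "\<dots> = (\<Sum>n\<in>{?n}. pmf (replicate_pmf n (geometric_pmf (1 - q))) w *
      pmf (count_pmf (t / (1 - q))) n)"
    by (rule integral_measure_pmf_real) (auto simp: pmf_replicate split: if_splits)
  also have "\<dots> = (\<Prod>k\<leftarrow>w. q ^ k * (1 - q)) * ((t / (1 - q)) ^ ?n / fact ?n * exp (- (t / (1 - q))))"
    using q t by (simp add: pmf_replicate pmf_count geo)
  also have "(\<Prod>k\<leftarrow>w. q ^ k * (1 - q)) = (\<Prod>k\<leftarrow>w. q ^ k) * (1 - q) ^ ?n"
    by (induction w) auto
  finally show ?thesis using q by (simp add: power_divide)
qed

text \<open>
  Since the probabilities of the events \<open>rings_in_order w t\<close> add up to 1, no separate argument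
  is needed for the almost sure absence of simultaneous rings and of infinitely many rings: an
  inequality between two probability measures on all subsets is an equality.
\<close>

lemma tasep_law_eq:
  assumes q: "0 < q" "q < 1" and t: "0 \<le> t"
  shows "tasep_law q t = measure_pmf (bind_pmf (count_pmf (t / (1 - q))) (\<lambda>n. run q n step_config))"
proof -
  interpret prob_space "clocks q" using q(1) by (rule prob_space_clocks)
  let ?F = "\<lambda>w. fold jump w step_config"
  have W: "bind_pmf (count_pmf (t / (1 - q))) (\<lambda>n. run q n step_config) = map_pmf ?F (words q t)"
    by (simp add: words_def run_def map_bind_pmf)
  have "AE \<omega> in clocks q. \<forall>i. 0 < \<omega> i"
    unfolding AE_all_countable
  proof
    fix i :: "nat \<times> nat"
    have "AE x in wait q i. 0 < x"
      unfolding wait_def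
      by (subst AE_density, simp, use AE_lborel_singleton[of "0::real"] in eventually_elim)
        (auto simp: exponential_density_def split: if_splits)
    then show "AE \<omega> in clocks q. 0 < \<omega> i"
      unfolding clocks_eq using prob_space_wait[OF q(1)] by (intro AE_PiM_component) auto
  qed
  then obtain N where N: "{\<omega>. \<not> (\<forall>i. 0 < \<omega> i)} \<subseteq> N" "N \<in> sets (clocks q)" "emeasure (clocks q) N = 0"
    by (auto elim: AE_E)
  \<comment> \<open>Off the null set \<open>N\<close> all waiting times are positive, so on
    \<open>G w\<close> the word of ringing labels is \<open>w\<close>; this also makes the sets
    disjoint.\<close>
  define G where "G w = {\<omega>. rings_in_order w t \<omega>} - N" for w
  have G_sets: "G w \<in> sets (clocks q)" for w unfolding G_def using N(2) by auto
  have G: "emeasure (clocks q) (G w) = ennreal (pmf (words q t) w)" for w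
  proof -
    have "emeasure (clocks q) (G w) = emeasure (clocks q) {\<omega>. rings_in_order w t \<omega>}"
      unfolding G_def using N by (intro emeasure_Diff_null_set) (auto simp: null_sets_def)
    then show ?thesis using q t by (simp add: emeasure_rings_in_order pmf_words)
  qed
  have word: "map (ringing \<omega>) (sorted_list_of_set (rings_upto t \<omega>)) = w" if "\<omega> \<in> G w" for w \<omega>
  proof -
    have "\<forall>i. 0 < \<omega> i" "rings_in_order w t \<omega>" using that N(1) by (auto simp: G_def)
    then show ?thesis using word_if_rings_in_order by blast
  qed
  have tasep: "tasep t \<omega> = ?F w" if "\<omega> \<in> G w" for w \<omega>
    unfolding tasep_def word[OF that, symmetric] by (simp add: fold_map o_def)
  have disj: "disjoint_family_on G A" for A
    unfolding disjoint_family_on_def using word by blast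
  have law: "emeasure (tasep_law q t) A = emeasure (clocks q) (tasep t -` A)" for A
    unfolding tasep_law_def by (subst emeasure_distr[OF measurable_tasep]) auto
  have ge: "emeasure (measure_pmf (map_pmf ?F (words q t))) A \<le> emeasure (tasep_law q t) A" for A
  proof -
    let ?A = "?F -` A"
    have "emeasure (measure_pmf (map_pmf ?F (words q t))) A = emeasure (measure_pmf (words q t)) ?A"
      by simp
    also have "\<dots> = (\<integral>\<^sup>+w. ennreal (pmf (words q t) w) \<partial>count_space ?A)"
      by (rule nn_integral_pmf[symmetric])
    also have "\<dots> = (\<integral>\<^sup>+w. emeasure (clocks q) (G w) \<partial>count_space ?A)"
      by (simp add: G)
    also have "\<dots> = emeasure (clocks q) (\<Union>w\<in>?A. G w)"
      using G_sets disj by (intro emeasure_UN_countable[symmetric]) auto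
    also have "\<dots> \<le> emeasure (clocks q) (tasep t -` A)"
      using tasep measurable_sets[OF measurable_tasep, of A t q] by (intro emeasure_mono) auto
    finally show ?thesis unfolding law .
  qed
  interpret T: prob_space "tasep_law q t"
    unfolding tasep_law_def by (rule prob_space_distr[OF measurable_tasep])
  show ?thesis unfolding W
  proof (rule measure_eqI)
    show "sets (tasep_law q t) = sets (measure_pmf (map_pmf ?F (words q t)))"
      by (simp add: tasep_law_def)
    fix A assume "A \<in> sets (tasep_law q t)"
    let ?P = "measure_pmf (map_pmf ?F (words q t))"
    have le: "measure ?P B \<le> measure (tasep_law q t) B" for B
      using ge[of B] by (simp add: measure_pmf.emeasure_eq_measure T.emeasure_eq_measure)
    have "measure ?P (- A) = 1 - measure ?P A"
      using measure_pmf.prob_compl[of A] by (simp add: Compl_eq_Diff_UNIV)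
    moreover have "measure (tasep_law q t) (- A) = 1 - measure (tasep_law q t) A"
      using T.prob_compl[of A] by (simp add: Compl_eq_Diff_UNIV tasep_law_def)
    ultimately have "measure (tasep_law q t) A = measure ?P A"
      using le[of A] le[of "- A"] by linarith
    then show "emeasure (tasep_law q t) A = emeasure ?P A"
      by (simp add: measure_pmf.emeasure_eq_measure T.emeasure_eq_measure)
  qed
qed

section \<open>Invariance of the step configuration, and the slowed-down law\<close>

lemma Lmap_step_config:
  assumes "0 \<le> q" "q \<le> 1"
  shows "Lmap q step_config = return_pmf step_config"
proof -
  have "gap step_config k = 0" for k by (simp add: gap_def part_step_config)
  then show ?thesis using Lmap_eq_sweep[OF assms, of 0 step_config] by simp
qed

theorem theorem5p7:
  fixes q t :: real
  assumes "0 < q" and "q < 1" and "0 \<le> t"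
  shows "tasep_law q t \<bind> (\<lambda>x. measure_pmf (Lmap q x)) = tasep_law q (q * t)"
proof -
  let ?run = "\<lambda>n. run q n step_config" and ?r = "t / (1 - q)"
  have r: "0 \<le> ?r" using assms by simp
  \<comment> \<open>\<open>run_Lmap\<close> moves the resampling to the start of the run, where it
    fixes the step configuration; only the binomial thinning remains.\<close>
  have "bind_pmf (bind_pmf (count_pmf ?r) ?run) (Lmap q) =
      bind_pmf (bind_pmf (count_pmf ?r) (\<lambda>n. binomial_pmf n q)) ?run"
    using assms by (simp add: bind_assoc_pmf run_Lmap Lmap_step_config bind_return_pmf)
  also have "\<dots> = bind_pmf (count_pmf (q * t / (1 - q))) ?run"
    using assms r by (simp add: count_binomial)
  finally have "measure_pmf (bind_pmf (bind_pmf (count_pmf ?r) ?run) (Lmap q)) = tasep_law q (q * t)"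
    using assms by (simp add: tasep_law_eq)
  then show ?thesis
    using assms by (simp add: tasep_law_eq measure_pmf_bind)
qed

end
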